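(* Let $P$ be an operator of isotropic elastodynamics on $\mathbb{R}\times\overline\Omega$, $\Omega\subset\mathbb{R}^3$ a bounded domain with smooth boundary, such that $\mu(x)|\xi|^2+R(x)\xi\cdot\xi>0$ for all $(x,\xi)\in T^*(\overline\Omega)\setminus0$. Then the scalar symbols $$q_{S}(t,x,\tau,\xi)=\rho(x)\big(\tau^2-\langle\xi,\xi\rangle_{S}\big),\qquad q_{P}(t,x,\tau,\xi)=\rho(x)\big(\tau^2-\langle\xi,\xi\rangle_{P}\big)$$ and their product $q_Sq_P$ are of real principal type, and $P$ is a system of real principal type with principal symbol $$p=q_S(\mathrm{Id}_3-\pi)+q_P\,\pi,\qquad \pi=\pi(\xi)=(\xi\otimes\xi)/(\xi\cdot\xi).$$
   Context: An operator of isotropic elastodynamics is $$Pu=-\rho\,\partial_t^2u+\nabla\cdot\big(R+(\nabla u)R+\lambda\,\mathrm{tr}(E)I+2\mu E\big),\quad E=\tfrac12(\nabla u+(\nabla u)^T),$$ acting on displacement fields $u(t,x)\in\mathbb{R}^3$, where $0<\rho,\lambda,\mu\in C^\infty(\overline{\Omega})$, and $R\in C^\infty(\overline\Omega)$ takes values in symmetric $3\times3$ matrices with $\nabla\cdot R=0$ (so $P$ is linear). Here $(\nabla u)_{ij}=\partial_ju_i$ and $(\nabla\cdot S)_i=\sum_j\partial_jS_{ij}$. $\langle\xi,\xi\rangle_S=(\mu|\xi|^2+R\xi\cdot\xi)/\rho$ and $\langle\xi,\xi\rangle_P=((\lambda+2\mu)|\xi|^2+R\xi\cdot\xi)/\rho$.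 $(t,x,\tau,\xi)$ is a point of $T^*(\mathbb{R}\times\overline\Omega)\setminus0$; at $\xi=0$, where $q_S=q_P$, the formula for $p$ is read as $\rho\tau^2\mathrm{Id}_3$. Principal symbols are taken with respect to $D=-i\partial$. A scalar real homogeneous symbol $q$ is of real principal type if its Hamilton field $H_q$ is non-vanishing and non-radial on $q=0$. A square system with principal symbol $p$ is of real principal type (Dencker) if, microlocally near each point, there are a scalar symbol $q$ of real principal type and a matrix symbol $\tilde p$ with $\tilde pp=q\,\mathrm{Id}$ and the characteristic variety $\det p=0$ is given by $q=0$. *)

theory Defs
  imports "HOL-Analysis.Analysis"
begin

section \<open>Smooth functions\<close>

text \<open>On an open set of a finite-dimensional space, \<open>f\<close> is \<open>C\<^sup>k\<^sup>+\<^sup>1\<close> iff it is differentiable and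
  all its directional derivatives are \<open>C\<^sup>k\<close>.\<close>

primrec Ck_open :: "nat \<Rightarrow> 'a::euclidean_space set \<Rightarrow> ('a \<Rightarrow> 'b::real_normed_vector) \<Rightarrow> bool" where
  "Ck_open 0 V f \<longleftrightarrow> continuous_on V f"
| "Ck_open (Suc k) V f \<longleftrightarrow> (\<forall>x\<in>V. f differentiable (at x)) \<and>
      (\<forall>v. Ck_open k V (\<lambda>x. frechet_derivative f (at x) v))"

definition smooth_open :: "'a::euclidean_space set \<Rightarrow> ('a \<Rightarrow> 'b::real_normed_vector) \<Rightarrow> bool" where
  "smooth_open V f \<longleftrightarrow> (\<forall>k. Ck_open k V f)"

text \<open>On an arbitrary set (for instance the closure of a domain), smooth means that \<open>f\<close> has, near
  each point of the set, a smooth extension to an open set.\<close>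

definition smooth_on :: "'a::euclidean_space set \<Rightarrow> ('a \<Rightarrow> 'b::real_normed_vector) \<Rightarrow> bool" where
  "smooth_on S f \<longleftrightarrow>
     (\<forall>x\<in>S. \<exists>V g. open V \<and> x \<in> V \<and> smooth_open V g \<and> (\<forall>y\<in>S \<inter> V. g y = f y))"

text \<open>Smooth boundary: near each boundary point the set is the sublevel set \<open>\<phi> < 0\<close> of a smooth
  function without critical points (so the set lies locally on one side of its boundary).\<close>

definition smooth_bounded_domain :: "'a::euclidean_space set \<Rightarrow> bool" where
  "smooth_bounded_domain \<Omega> \<longleftrightarrow>
     open \<Omega> \<and> connected \<Omega> \<and> \<Omega> \<noteq> {} \<and> bounded \<Omega> \<and>
     (\<forall>x\<in>frontier \<Omega>. \<exists>V \<phi>. open V \<and> x \<in> V \<and> smooth_open V (\<phi> :: 'a \<Rightarrow> real) \<and>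
        (\<forall>y\<in>V. frechet_derivative \<phi> (at y) \<noteq> (\<lambda>_. 0)) \<and> \<Omega> \<inter> V = {y \<in> V. \<phi> y < 0})"


section \<open>Symbols of real principal type\<close>

text \<open>Points of the cotangent bundle are pairs \<open>(z, \<zeta>)\<close> of a base point and a covector; covectors are
  identified with vectors through the inner product.\<close>

definition cotangent0 :: "'a::euclidean_space set \<Rightarrow> ('a \<times> 'a) set" where
  "cotangent0 M = {(z, \<zeta>). z \<in> M \<and> \<zeta> \<noteq> 0}"

definition conic :: "('a::euclidean_space \<times> 'a) set \<Rightarrow> bool" where
  "conic U \<longleftrightarrow> (\<forall>(z, \<zeta>)\<in>U. \<forall>s>0. (z, s *\<^sub>R \<zeta>) \<in> U)"

definition homogeneous_symbol ::
    "('a::euclidean_space \<times> 'a) set \<Rightarrow> ('a \<times> 'a \<Rightarrow> 'b::real_normed_vector) \<Rightarrow> bool" where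
  "homogeneous_symbol U f \<longleftrightarrow> smooth_on U f \<and>
     (\<exists>m::real. \<forall>(z, \<zeta>)\<in>U. \<forall>s>0. f (z, s *\<^sub>R \<zeta>) = (s powr m) *\<^sub>R f (z, \<zeta>))"

text \<open>\<open>H\<^sub>q = (\<partial>\<^sub>\<zeta> q) \<partial>\<^sub>z - (\<partial>\<^sub>z q) \<partial>\<^sub>\<zeta>\<close>.  The derivative is taken within \<open>U\<close>, because the base points may
  lie on the boundary of a domain; at interior points it is the usual derivative, and at points of
  a smooth boundary it is the derivative of any smooth extension.\<close>

definition hamilton_field ::
    "('a::euclidean_space \<times> 'a) set \<Rightarrow> ('a \<times> 'a \<Rightarrow> real) \<Rightarrow> 'a \<times> 'a \<Rightarrow> 'a \<times> 'a" where
  "hamilton_field U q w =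
     (let dq = frechet_derivative q (at w within U) in
       (\<Sum>b\<in>Basis. dq (0, b) *\<^sub>R b, - (\<Sum>b\<in>Basis. dq (b, 0) *\<^sub>R b)))"

text \<open>The radial field at \<open>(z, \<zeta>)\<close> is \<open>\<zeta> \<partial>\<^sub>\<zeta> = (0, \<zeta>)\<close>.  The set \<open>U\<close> is meant to be a conic, relatively
  open subset of a cotangent bundle without its zero section.\<close>

definition real_principal_type ::
    "('a::euclidean_space \<times> 'a) set \<Rightarrow> ('a \<times> 'a \<Rightarrow> real) \<Rightarrow> bool" where
  "real_principal_type U q \<longleftrightarrow> homogeneous_symbol U q \<and>
     (\<forall>w\<in>U. q w = 0 \<longrightarrow>
        hamilton_field U q w \<noteq> 0 \<and> (\<forall>c. hamilton_field U q w \<noteq> c *\<^sub>R (0, snd w)))"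

definition real_principal_type_system ::
    "'a::euclidean_space set \<Rightarrow> ('a \<times> 'a \<Rightarrow> complex^'n^'n) \<Rightarrow> bool" where
  "real_principal_type_system M p \<longleftrightarrow>
     (\<forall>w\<in>cotangent0 M. \<exists>U q p'.
        w \<in> U \<and> openin (top_of_set (cotangent0 M)) U \<and> conic U \<and>
        real_principal_type U q \<and> homogeneous_symbol U (p' :: 'a \<times> 'a \<Rightarrow> complex^'n^'n) \<and>
        (\<forall>v\<in>U. p' v ** p v = mat (complex_of_real (q v))) \<and>
        (\<forall>v\<in>U. det (p v) = 0 \<longleftrightarrow> q v = 0))"


section \<open>Differential operators and their principal symbols\<close>

text \<open>\<open>D_word [b\<^sub>1, \<dots>, b\<^sub>k] u = D\<^sub>b\<^sub>1 \<dots> D\<^sub>b\<^sub>k u\<close> with \<open>D = -\<i> \<partial>\<close>.\<close>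

primrec D_word ::
    "'a::euclidean_space list \<Rightarrow> ('a \<Rightarrow> complex^'n) \<Rightarrow> ('a \<Rightarrow> complex^'n)" where
  "D_word [] u = u"
| "D_word (b # bs) u = (\<lambda>z. (- \<i>) *s frechet_derivative (D_word bs u) (at z) b)"

text \<open>On the open set \<open>X\<close>, \<open>P\<close> is a linear differential operator of order at most \<open>m\<close> with
  coefficients smooth up to the boundary, and the part of order \<open>m\<close> has symbol \<open>p\<close>, which lives
  over \<open>closure X\<close>.  Mixed derivatives are indexed by words of basis vectors instead of
  multi-indices; the coefficients are then not unique, but the sum giving \<open>p\<close> is.\<close>

definition has_principal_symbol ::
    "'a::euclidean_space set \<Rightarrow> nat \<Rightarrow> (('a \<Rightarrow> complex^'n) \<Rightarrow> ('a \<Rightarrow> complex^'n)) \<Rightarrow>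
     ('a \<times> 'a \<Rightarrow> complex^'n^'n) \<Rightarrow> bool" where
  "has_principal_symbol X m P p \<longleftrightarrow>
     (\<exists>A :: 'a list \<Rightarrow> 'a \<Rightarrow> complex^'n^'n.
        (\<forall>bs. smooth_on (closure X) (A bs)) \<and>
        (\<forall>u. smooth_open X u \<longrightarrow> (\<forall>z\<in>X.
           P u z = (\<Sum>bs | set bs \<subseteq> Basis \<and> length bs \<le> m. A bs z *v D_word bs u z))) \<and>
        (\<forall>(z, \<zeta>)\<in>cotangent0 (closure X).
           p (z, \<zeta>) = (\<Sum>bs | set bs \<subseteq> Basis \<and> length bs = m. (\<Prod>b\<leftarrow>bs. \<zeta> \<bullet> b) *\<^sub>R A bs z)))"

text \<open>Extension of an operator on real fields to complex fields, \<open>u + \<i> v \<mapsto> P u + \<i> P v\<close>; this is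
  needed for \<open>D = -\<i> \<partial>\<close> to act.\<close>

definition complexify_op ::
    "(('a \<Rightarrow> real^'n) \<Rightarrow> ('a \<Rightarrow> real^'n)) \<Rightarrow> ('a \<Rightarrow> complex^'n) \<Rightarrow> ('a \<Rightarrow> complex^'n)" where
  "complexify_op P u z =
     (\<chi> k. Complex (P (\<lambda>y. \<chi> j. Re (u y $ j)) z $ k) (P (\<lambda>y. \<chi> j. Im (u y $ j)) z $ k))"

definition complexify_matrix :: "real^'n^'m \<Rightarrow> complex^'n^'m" where
  "complexify_matrix A = (\<chi> i j. complex_of_real (A $ i $ j))"


section \<open>Isotropic elastodynamics\<close>

type_synonym spacetime = "real \<times> (real^3)"

definition matrix_div :: "(real^3 \<Rightarrow> real^3^3) \<Rightarrow> real^3 \<Rightarrow> real^3" where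
  "matrix_div S x = (\<chi> i. \<Sum>j\<in>UNIV. frechet_derivative (\<lambda>y. S y $ i $ j) (at x) (axis j 1))"

text \<open>Note that \<open>jacobian v (at x) $ i $ j\<close> is \<open>\<partial>\<^sub>j v\<^sub>i\<close>.\<close>

definition strain :: "(real^3 \<Rightarrow> real^3) \<Rightarrow> real^3 \<Rightarrow> real^3^3" where
  "strain v x = (1/2) *\<^sub>R (jacobian v (at x) + transpose (jacobian v (at x)))"

definition stress :: "(real^3 \<Rightarrow> real) \<Rightarrow> (real^3 \<Rightarrow> real) \<Rightarrow> (real^3 \<Rightarrow> real^3^3) \<Rightarrow>
    (real^3 \<Rightarrow> real^3) \<Rightarrow> real^3 \<Rightarrow> real^3^3" where
  "stress lam mu R v x = R x + jacobian v (at x) ** R x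
     + (lam x * trace (strain v x)) *\<^sub>R mat 1 + (2 * mu x) *\<^sub>R strain v x"

definition elastic_op :: "(real^3 \<Rightarrow> real) \<Rightarrow> (real^3 \<Rightarrow> real) \<Rightarrow> (real^3 \<Rightarrow> real) \<Rightarrow>
    (real^3 \<Rightarrow> real^3^3) \<Rightarrow> (spacetime \<Rightarrow> real^3) \<Rightarrow> (spacetime \<Rightarrow> real^3)" where
  "elastic_op rho lam mu R u = (\<lambda>(t, x).
     - (rho x *\<^sub>R vector_derivative (\<lambda>s. vector_derivative (\<lambda>r. u (r, x)) (at s)) (at t))
     + matrix_div (stress lam mu R (\<lambda>y. u (t, y))) x)"

definition elastic_coefficients :: "(real^3) set \<Rightarrow> (real^3 \<Rightarrow> real) \<Rightarrow> (real^3 \<Rightarrow> real) \<Rightarrow>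
    (real^3 \<Rightarrow> real) \<Rightarrow> (real^3 \<Rightarrow> real^3^3) \<Rightarrow> bool" where
  "elastic_coefficients \<Omega> rho lam mu R \<longleftrightarrow>
     smooth_on (closure \<Omega>) rho \<and> smooth_on (closure \<Omega>) lam \<and> smooth_on (closure \<Omega>) mu \<and>
     smooth_on (closure \<Omega>) R \<and>
     (\<forall>x\<in>closure \<Omega>. rho x > 0 \<and> lam x > 0 \<and> mu x > 0 \<and> transpose (R x) = R x) \<and>
     (\<forall>x\<in>\<Omega>. matrix_div R x = 0)"

definition form_S :: "(real^3 \<Rightarrow> real) \<Rightarrow> (real^3 \<Rightarrow> real) \<Rightarrow> (real^3 \<Rightarrow> real^3^3) \<Rightarrow> 
    real^3 \<Rightarrow> real^3 \<Rightarrow> real" where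
  "form_S rho mu R x \<xi> = (mu x * (norm \<xi>)\<^sup>2 + (R x *v \<xi>) \<bullet> \<xi>) / rho x"

definition form_P :: "(real^3 \<Rightarrow> real) \<Rightarrow> (real^3 \<Rightarrow> real) \<Rightarrow> (real^3 \<Rightarrow> real) \<Rightarrow> 
    (real^3 \<Rightarrow> real^3^3) \<Rightarrow> real^3 \<Rightarrow> real^3 \<Rightarrow> real" where
  "form_P rho lam mu R x \<xi> =
     ((lam x + 2 * mu x) * (norm \<xi>)\<^sup>2 + (R x *v \<xi>) \<bullet> \<xi>) / rho x"

definition q_S :: "(real^3 \<Rightarrow> real) \<Rightarrow> (real^3 \<Rightarrow> real) \<Rightarrow> (real^3 \<Rightarrow> real^3^3) \<Rightarrow>
    spacetime \<times> spacetime \<Rightarrow> real" where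
  "q_S rho mu R = (\<lambda>((t, x), (\<tau>, \<xi>)). rho x * (\<tau>\<^sup>2 - form_S rho mu R x \<xi>))"

definition q_P :: "(real^3 \<Rightarrow> real) \<Rightarrow> (real^3 \<Rightarrow> real) \<Rightarrow> (real^3 \<Rightarrow> real) \<Rightarrow>
    (real^3 \<Rightarrow> real^3^3) \<Rightarrow> spacetime \<times> spacetime \<Rightarrow> real" where
  "q_P rho lam mu R = (\<lambda>((t, x), (\<tau>, \<xi>)). rho x * (\<tau>\<^sup>2 - form_P rho lam mu R x \<xi>))"

definition proj :: "real^3 \<Rightarrow> real^3^3" where
  "proj \<xi> = (\<chi> i j. \<xi> $ i * \<xi> $ j / (\<xi> \<bullet> \<xi>))"

definition elastic_symbol :: "(real^3 \<Rightarrow> real) \<Rightarrow> (real^3 \<Rightarrow> real) \<Rightarrow> (real^3 \<Rightarrow> real) \<Rightarrow>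
    (real^3 \<Rightarrow> real^3^3) \<Rightarrow> spacetime \<times> spacetime \<Rightarrow> real^3^3" where
  "elastic_symbol rho lam mu R = (\<lambda>((t, x), (\<tau>, \<xi>)).
     if \<xi> = 0 then (rho x * \<tau>\<^sup>2) *\<^sub>R mat 1
     else q_S rho mu R ((t, x), (\<tau>, \<xi>)) *\<^sub>R (mat 1 - proj \<xi>)
          + q_P rho lam mu R ((t, x), (\<tau>, \<xi>)) *\<^sub>R proj \<xi>)"

end

theory Submission
  imports Defs
begin

text \<open>Since \<open>q\<^sub>S - q\<^sub>P = (\<lambda> + \<mu>)|\<xi>|\<^sup>2\<close>, the symbol is the polynomial \<open>p = q\<^sub>S Id - (\<lambda> + \<mu>) \<xi> \<otimes> \<xi>\<close>, with
  determinant \<open>q\<^sub>S\<^sup>2 q\<^sub>P\<close>, and \<open>p' = q\<^sub>P Id + (\<lambda> + \<mu>) \<xi> \<otimes> \<xi>\<close> satisfies \<open>p' p = q\<^sub>S q\<^sub>P Id\<close> globally; no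
  singularity of \<open>\<pi>\<close> at \<open>\<xi> = 0\<close> remains.  On the characteristic sets \<open>\<xi> \<noteq> 0\<close> and hence \<open>\<tau> \<noteq> 0\<close>, because
  both quadratic forms are positive definite.  There \<open>\<partial>\<^sub>\<tau> q\<^sub>S = \<partial>\<^sub>\<tau> q\<^sub>P = 2\<rho>\<tau> \<noteq> 0\<close>, and \<open>q\<^sub>S\<close> and \<open>q\<^sub>P\<close> do not
  vanish simultaneously, so the Hamilton fields have a nonzero time component and are not radial.
  In the operator, the terms where a derivative falls on \<open>R\<close> cancel by \<open>\<nabla> \<cdot> R = 0\<close>; the remaining first order
  coefficients are gradients of \<open>\<lambda>\<close> and \<open>\<mu>\<close>, which extend smoothly to the closure.\<close>


section \<open>Calculus of smooth functions\<close>

text \<open>At a point of an open set, \<open>frechet_derivative\<close> depends only on the germ,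
  so agreement on \<open>V\<close> passes to all derivatives. The later inductions use this to
  replace the chosen derivative by an explicit formula.\<close>

lemma Ck_open_cong:
  assumes "open V" "\<And>x. x \<in> V \<Longrightarrow> f x = g x" "Ck_open k V f"
  shows "Ck_open k V g"
  using assms(2,3)
proof (induction k arbitrary: f g)
  case 0
  then show ?case unfolding Ck_open.simps using continuous_on_cong[of V V f g] by blast
next
  case (Suc k)
  have "g differentiable (at x)" if "x \<in> V" for x
  proof -
    have "(f has_derivative frechet_derivative f (at x)) (at x)"
      using Suc.prems(2) that by (simp add: frechet_derivative_works[symmetric])
    from has_derivative_transform_within_open[OF this assms(1) that Suc.prems(1)]
    show ?thesis by (auto simp: differentiable_def)
  qed
  moreover have "Ck_open k V (\<lambda>x. frechet_derivative g (at x) v)" for v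
  proof (rule Suc.IH)
    show "Ck_open k V (\<lambda>x. frechet_derivative f (at x) v)" using Suc.prems(2) by simp
    show "frechet_derivative f (at x) v = frechet_derivative g (at x) v" if "x \<in> V" for x
    proof -
      have "f differentiable (at x)" using Suc.prems(2) that by simp
      from frechet_derivative_transform_within_open[OF this assms(1) that Suc.prems(1)]
      show ?thesis by simp
    qed
  qed
  ultimately show ?case by simp
qed

lemma Ck_open_subset: "Ck_open k V f \<Longrightarrow> W \<subseteq> V \<Longrightarrow> Ck_open k W f"
  by (induction k arbitrary: f) (auto intro: continuous_on_subset)

text \<open>The recursion at order \<open>Suc k\<close> does not mention continuity of the function
  itself; it comes from differentiability at the bottom of the induction.\<close>

lemma Ck_open_SucD: "Ck_open (Suc k) V f \<Longrightarrow> Ck_open k V f"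
proof (induction k arbitrary: f)
  case 0
  then show ?case
    by (simp add: continuous_at_imp_continuous_on differentiable_imp_continuous_within)
next
  case (Suc k)
  have "Ck_open k V (\<lambda>x. frechet_derivative f (at x) v)" for v
    using Suc.prems unfolding Ck_open.simps(2)[of "Suc k"] by (intro Suc.IH) blast
  moreover have "\<forall>x\<in>V. f differentiable (at x)"
    using Suc.prems unfolding Ck_open.simps(2)[of "Suc k"] by blast
  ultimately show ?case unfolding Ck_open.simps(2) by blast
qed

lemma Ck_open_const: "Ck_open k V (\<lambda>x. c)"
  by (induction k arbitrary: c) simp_all

lemma Ck_open_add:
  assumes "open V" "Ck_open k V f" "Ck_open k V g"
  shows "Ck_open k V (\<lambda>x. f x + g x)"
  using assms(2,3)
proof (induction k arbitrary: f g)
  case 0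
  then show ?case by (simp add: continuous_on_add)
next
  case (Suc k)
  have "Ck_open k V (\<lambda>x. frechet_derivative (\<lambda>x. f x + g x) (at x) v)" for v
  proof (rule Ck_open_cong[OF assms(1)])
    show "Ck_open k V (\<lambda>x. frechet_derivative f (at x) v + frechet_derivative g (at x) v)"
      using Suc by simp
    show "frechet_derivative f (at x) v + frechet_derivative g (at x) v
      = frechet_derivative (\<lambda>x. f x + g x) (at x) v" if "x \<in> V" for x
    proof -
      have "((\<lambda>x. f x + g x) has_derivative
          (\<lambda>v. frechet_derivative f (at x) v + frechet_derivative g (at x) v)) (at x)"
        using Suc.prems that
        by (intro has_derivative_add) (simp_all add: frechet_derivative_works[symmetric])
      from fun_cong[OF frechet_derivative_at[OF this]] show ?thesis .
    qed
  qed
  then show ?case using Suc.prems by simp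
qed

text \<open>The Leibniz rule yields products of the same kind with one factor differentiated, so the
  induction quantifies over both factors.\<close>

lemma (in bounded_bilinear) Ck_open_prod:
  assumes "open V" "Ck_open k V f" "Ck_open k V g"
  shows "Ck_open k V (\<lambda>x. prod (f x) (g x))"
  using assms(2,3)
proof (induction k arbitrary: f g)
  case 0
  then show ?case by (simp add: continuous_on)
next
  case (Suc k)
  have der: "((\<lambda>x. prod (f x) (g x)) has_derivative
      (\<lambda>v. prod (f x) (frechet_derivative g (at x) v) + prod (frechet_derivative f (at x) v) (g x)))
      (at x)" if "x \<in> V" for x
    using FDERIV[of f "frechet_derivative f (at x)" x UNIV g "frechet_derivative g (at x)"]
      Suc.prems that by (simp add: frechet_derivative_works[symmetric])
  have "Ck_open k V (\<lambda>x. frechet_derivative (\<lambda>x. prod (f x) (g x)) (at x) v)" for v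
  proof (rule Ck_open_cong[OF assms(1)])
    show "Ck_open k V (\<lambda>x. prod (f x) (frechet_derivative g (at x) v)
        + prod (frechet_derivative f (at x) v) (g x))"
      \<comment> \<open>Undifferentiated factors lose one order by \<open>Ck_open_SucD\<close>;
        differentiated ones have order \<open>k\<close> by definition.\<close>
      using Suc.prems by (intro Ck_open_add[OF assms(1)] Suc.IH)
        (simp_all add: Ck_open_SucD del: Ck_open.simps, simp_all)
    show "prod (f x) (frechet_derivative g (at x) v) + prod (frechet_derivative f (at x) v) (g x)
        = frechet_derivative (\<lambda>x. prod (f x) (g x)) (at x) v" if "x \<in> V" for x
      by (rule fun_cong[OF frechet_derivative_at[OF der[OF that]]])
  qed
  then show ?case using der by (auto simp: differentiable_def)
qed

text \<open>The derivative along \<open>v\<close> is again a pullback by \<open>L\<close>, namely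
  that of the derivative of \<open>f\<close> along \<open>L v\<close>, which closes the induction.
  This later transports functions of position to spacetime and phase space.\<close>

lemma Ck_open_compose_linear:
  assumes "open V" "bounded_linear L" "Ck_open k V f"
  shows "Ck_open k (L -` V) (\<lambda>x. f (L x))"
  using assms(3)
proof (induction k arbitrary: f)
  case 0
  have "continuous_on (L -` V) L"
    by (simp add: assms(2) linear_continuous_on)
  then show ?case
    using 0 continuous_on_compose2[of V f "L -` V" L] by auto
next
  case (Suc k)
  have der: "((\<lambda>x. f (L x)) has_derivative (\<lambda>v. frechet_derivative f (at (L x)) (L v))) (at x)"
    if "L x \<in> V" for x
  proof -
    have "(f has_derivative frechet_derivative f (at (L x))) (at (L x))"
      using Suc.prems that by (simp add: frechet_derivative_works[symmetric])
    from has_derivative_compose[OF bounded_linear_imp_has_derivative[OF assms(2)] this]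
    show ?thesis .
  qed
  have op: "open (L -` V)"
    using assms(1,2) by (simp add: linear_continuous_on open_vimage)
  have "Ck_open k (L -` V) (\<lambda>x. frechet_derivative (\<lambda>x. f (L x)) (at x) v)" for v
  proof (rule Ck_open_cong[OF op])
    show "Ck_open k (L -` V) (\<lambda>x. frechet_derivative f (at (L x)) (L v))"
      using Suc.prems by (intro Suc.IH[of "\<lambda>y. frechet_derivative f (at y) (L v)"]) auto
    show "frechet_derivative f (at (L x)) (L v) = frechet_derivative (\<lambda>x. f (L x)) (at x) v"
      if "x \<in> L -` V" for x
      using fun_cong[OF frechet_derivative_at[OF der], of x v] that by simp
  qed
  then show ?case using der by (auto simp: differentiable_def)
qed

lemma (in bounded_linear) Ck_open_compose:
  assumes "open V" "Ck_open k V g"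
  shows "Ck_open k V (\<lambda>x. f (g x))"
  using assms(2)
proof (induction k arbitrary: g)
  case 0
  then show ?case by (simp add: continuous_on)
next
  case (Suc k)
  have der: "((\<lambda>x. f (g x)) has_derivative (\<lambda>v. f (frechet_derivative g (at x) v))) (at x)"
    if "x \<in> V" for x
    using Suc.prems that by (intro has_derivative) (simp add: frechet_derivative_works[symmetric])
  have "Ck_open k V (\<lambda>x. frechet_derivative (\<lambda>x. f (g x)) (at x) v)" for v
  proof (rule Ck_open_cong[OF assms(1)])
    show "Ck_open k V (\<lambda>x. f (frechet_derivative g (at x) v))"
      using Suc.prems by (intro Suc.IH) auto
    show "f (frechet_derivative g (at x) v) = frechet_derivative (\<lambda>x. f (g x)) (at x) v"
      if "x \<in> V" for x
      by (rule fun_cong[OF frechet_derivative_at[OF der[OF that]]])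
  qed
  then show ?case using der by (auto simp: differentiable_def)
qed

text \<open>In each direction the derivative of \<open>L\<close> is a constant function of the base
  point.\<close>

lemma Ck_open_linear:
  assumes "open V" "bounded_linear L"
  shows "Ck_open k V L"
proof (cases k)
  case (Suc j)
  have "Ck_open j V (\<lambda>x. frechet_derivative L (at x) v)" for v
    using frechet_derivative_at[OF bounded_linear_imp_has_derivative[OF assms(2)], symmetric]
    by (simp add: Ck_open_const)
  then show ?thesis
    using Suc assms(2) bounded_linear_imp_differentiable by auto
qed (simp add: assms linear_continuous_on)

section \<open>Smooth functions on open sets and on arbitrary sets\<close>

lemma smooth_open_SucD: "smooth_open V f \<Longrightarrow> Ck_open (Suc k) V f"
  by (simp only: smooth_open_def)

lemma smooth_open_differentiable: "smooth_open V f \<Longrightarrow> x \<in> V \<Longrightarrow> f differentiable (at x)"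
  using smooth_open_SucD[of V f 0] by simp

lemma smooth_open_frechet_derivative:
  "smooth_open V f \<Longrightarrow> smooth_open V (\<lambda>x. frechet_derivative f (at x) v)"
  using smooth_open_SucD[of V f] unfolding smooth_open_def[of V "\<lambda>x. frechet_derivative f (at x) v"]
  by simp

lemma smooth_open_imp_continuous_on: "smooth_open V f \<Longrightarrow> continuous_on V f"
  unfolding smooth_open_def by (drule spec[of _ 0]) simp

lemma smooth_onI:
  assumes "\<And>x. x \<in> S \<Longrightarrow> \<exists>V g. open V \<and> x \<in> V \<and> smooth_open V g \<and> (\<forall>y\<in>S \<inter> V. g y = f y)"
  shows "smooth_on S f"
  using assms by (simp add: smooth_on_def)

lemma smooth_onE:
  assumes "smooth_on S f" "x \<in> S"
  obtains V g where "open V" "x \<in> V" "smooth_open V g" "\<forall>y\<in>S \<inter> V. g y = f y"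
  using assms unfolding smooth_on_def by blast

lemma smooth_on_cong:
  assumes "\<And>x. x \<in> S \<Longrightarrow> f x = g x" "smooth_on S f"
  shows "smooth_on S g"
proof (rule smooth_onI)
  fix x assume "x \<in> S"
  obtain V h where
    "open V" "x \<in> V" "smooth_open V h" "\<forall>y\<in>S \<inter> V. h y = f y"
    using assms(2) \<open>x \<in> S\<close> by (rule smooth_onE)
  with assms(1) show "\<exists>V h. open V \<and> x \<in> V \<and> smooth_open V h \<and> (\<forall>y\<in>S \<inter> V. h y = g y)"
    by (intro exI[of _ V] exI[of _ h]) simp
qed

lemma smooth_on_const: "smooth_on S (\<lambda>x. c)"
  by (intro smooth_onI exI[of _ UNIV] exI[of _ "\<lambda>x. c"]) (simp add: smooth_open_def Ck_open_const)

lemma smooth_on_linear: "bounded_linear L \<Longrightarrow> smooth_on S L"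
  using Ck_open_linear[of UNIV L] by (intro smooth_onI exI[of _ UNIV] exI[of _ L]) (simp add: smooth_open_def)

lemma smooth_on_add:
  assumes "smooth_on S f" "smooth_on S g"
  shows "smooth_on S (\<lambda>x. f x + g x)"
proof (rule smooth_onI)
  fix x assume "x \<in> S"
  obtain V f' where V: "open V" "x \<in> V" "smooth_open V f'" "\<forall>y\<in>S \<inter> V. f' y = f y"
    using assms(1) \<open>x \<in> S\<close> by (rule smooth_onE)
  obtain W g' where W: "open W" "x \<in> W" "smooth_open W g'" "\<forall>y\<in>S \<inter> W. g' y = g y"
    using assms(2) \<open>x \<in> S\<close> by (rule smooth_onE)
  have "smooth_open (V \<inter> W) (\<lambda>x. f' x + g' x)"
    using V W Ck_open_subset[of _ V f' "V \<inter> W"] Ck_open_subset[of _ W g' "V \<inter> W"]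
    by (simp add: smooth_open_def Ck_open_add open_Int)
  with V W show "\<exists>V g'. open V \<and> x \<in> V \<and> smooth_open V g' \<and> (\<forall>y\<in>S \<inter> V. g' y = f y + g y)"
    by (intro exI[of _ "V \<inter> W"] exI[of _ "\<lambda>x. f' x + g' x"]) auto
qed

lemma (in bounded_bilinear) smooth_on_prod:
  assumes "smooth_on S f" "smooth_on S g"
  shows "smooth_on S (\<lambda>x. prod (f x) (g x))"
proof (rule smooth_onI)
  fix x assume "x \<in> S"
  obtain V f' where V: "open V" "x \<in> V" "smooth_open V f'" "\<forall>y\<in>S \<inter> V. f' y = f y"
    using assms(1) \<open>x \<in> S\<close> by (rule smooth_onE)
  obtain W g' where W: "open W" "x \<in> W" "smooth_open W g'" "\<forall>y\<in>S \<inter> W. g' y = g y"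
    using assms(2) \<open>x \<in> S\<close> by (rule smooth_onE)
  have "smooth_open (V \<inter> W) (\<lambda>x. prod (f' x) (g' x))"
    using V W Ck_open_subset[of _ V f' "V \<inter> W"] Ck_open_subset[of _ W g' "V \<inter> W"]
    by (simp add: smooth_open_def Ck_open_prod open_Int)
  with V W show "\<exists>V h. open V \<and> x \<in> V \<and> smooth_open V h \<and> (\<forall>y\<in>S \<inter> V. h y = prod (f y) (g y))"
    by (intro exI[of _ "V \<inter> W"] exI[of _ "\<lambda>x. prod (f' x) (g' x)"]) auto
qed

lemmas smooth_on_mult = bounded_bilinear.smooth_on_prod[OF bounded_bilinear_mult]

lemma (in bounded_linear) smooth_on_compose:
  assumes "smooth_on S g"
  shows "smooth_on S (\<lambda>x. f (g x))"
proof (rule smooth_onI)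
  fix x assume "x \<in> S"
  obtain V g' where V: "open V" "x \<in> V" "smooth_open V g'" "\<forall>y\<in>S \<inter> V. g' y = g y"
    using assms(1) \<open>x \<in> S\<close> by (rule smooth_onE)
  then show "\<exists>V h. open V \<and> x \<in> V \<and> smooth_open V h \<and> (\<forall>y\<in>S \<inter> V. h y = f (g y))"
    by (intro exI[of _ V] exI[of _ "\<lambda>x. f (g' x)"]) (auto simp: smooth_open_def Ck_open_compose)
qed

lemma smooth_on_compose_linear:
  assumes "smooth_on S f" "bounded_linear L" "L ` T \<subseteq> S"
  shows "smooth_on T (\<lambda>x. f (L x))"
proof (rule smooth_onI)
  fix x assume "x \<in> T"
  then have "L x \<in> S" using assms(3) by blast
  with assms(1) obtain V g where V: "open V" "L x \<in> V" "smooth_open V g" "\<forall>y\<in>S \<inter> V. g y = f y"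
    by (rule smooth_onE)
  have "open (L -` V)"
    using V(1) assms(2) by (simp add: linear_continuous_on open_vimage)
  moreover have "smooth_open (L -` V) (\<lambda>x. g (L x))"
    using V(1,3) assms(2) by (simp add: smooth_open_def Ck_open_compose_linear)
  ultimately show "\<exists>V h. open V \<and> x \<in> V \<and> smooth_open V h \<and> (\<forall>y\<in>T \<inter> V. h y = f (L y))"
    using V assms(3) by (intro exI[of _ "L -` V"] exI[of _ "\<lambda>x. g (L x)"]) auto
qed

lemma smooth_on_minus: "smooth_on S f \<Longrightarrow> smooth_on S (\<lambda>x. - f x)"
  using bounded_linear.smooth_on_compose[OF bounded_linear_minus[OF bounded_linear_ident]] .

lemma smooth_on_diff: "smooth_on S f \<Longrightarrow> smooth_on S g \<Longrightarrow> smooth_on S (\<lambda>x. f x - g x)"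
  using smooth_on_add[of S f "\<lambda>x. - g x"] smooth_on_minus[of S g] by simp

lemma smooth_on_sum:
  "(\<And>i. i \<in> I \<Longrightarrow> smooth_on S (f i)) \<Longrightarrow> smooth_on S (\<lambda>x. \<Sum>i\<in>I. f i x)"
  by (induction I rule: infinite_finite_induct) (auto intro: smooth_on_const smooth_on_add)

lemma smooth_on_vec_nth:
  fixes f :: "'a::euclidean_space \<Rightarrow> 'b::euclidean_space^'n"
  shows "smooth_on S f \<Longrightarrow> smooth_on S (\<lambda>x. f x $ i)"
  by (rule bounded_linear.smooth_on_compose[OF bounded_linear_vec_nth])

text \<open>Writing the vector as a sum of images under the linear maps \<open>axis i\<close>
  reduces the claim to the rules for linear maps and sums.\<close>

lemma smooth_on_vec_lambda:
  fixes f :: "'a::euclidean_space \<Rightarrow> 'n::finite \<Rightarrow> 'b::euclidean_space"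
  assumes "\<And>i. smooth_on S (\<lambda>x. f x i)"
  shows "smooth_on S (\<lambda>x. \<chi> i. f x i)"
proof (rule smooth_on_cong)
  have "bounded_linear (axis i :: 'b \<Rightarrow> 'b^'n)" for i :: 'n
    unfolding linear_conv_bounded_linear[symmetric]
    by (rule linearI) (simp_all add: axis_def vec_eq_iff)
  from bounded_linear.smooth_on_compose[OF this assms]
  show "smooth_on S (\<lambda>x. \<Sum>i\<in>UNIV. axis i (f x i))"
    by (rule smooth_on_sum)
  show "(\<Sum>i\<in>UNIV. axis i (f x i)) = (\<chi> i. f x i)" for x
    by (simp add: vec_eq_iff axis_def if_distrib sum.delta cong: if_cong)
qed

text \<open>The boundary values of an extension are forced to be limits from inside, so the local
  extensions automatically agree on the closure.\<close>

lemma smooth_on_closure_extension: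
  fixes f :: "'a::euclidean_space \<Rightarrow> 'b::real_normed_vector"
  assumes "open \<Omega>"
    and ext: "\<And>x. x \<in> closure \<Omega> \<Longrightarrow>
      \<exists>V g. open V \<and> x \<in> V \<and> smooth_open V g \<and> (\<forall>y\<in>\<Omega> \<inter> V. g y = f y)"
  shows "\<exists>F. smooth_on (closure \<Omega>) F \<and> (\<forall>x\<in>\<Omega>. F x = f x)"
proof -
  \<comment> \<open>Off \<open>\<Omega>\<close> the values of \<open>f\<close> itself are discarded;
    only its limit from inside matters.\<close>
  define F where "F x = (if x \<in> \<Omega> then f x else Lim (at x within \<Omega>) f)" for x
  have eq: "g y = F y" if V: "open V" "smooth_open V g" "\<forall>y\<in>\<Omega> \<inter> V. g y = f y"
    and y: "y \<in> closure \<Omega>" "y \<in> V" for V g y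
  proof (cases "y \<in> \<Omega>")
    case True
    then show ?thesis using V y by (simp add: F_def)
  next
    case False
    \<comment> \<open>A closure point outside \<open>\<Omega>\<close> is a limit point of it, so the
      limit from inside is unique and \<open>Lim\<close> returns it.\<close>
    then have "y islimpt \<Omega>" using y(1) by (simp add: closure_def)
    then have nt: "\<not> trivial_limit (at y within \<Omega>)" by (simp add: trivial_limit_within)
    have "(g \<longlongrightarrow> g y) (at y within \<Omega>)"
      using smooth_open_imp_continuous_on[OF V(2)] V(1) y(2)
      by (meson continuous_on_eq_continuous_at isContD tendsto_within_subset subset_UNIV)
    moreover have "eventually (\<lambda>z. g z = f z) (at y within \<Omega>)"
      unfolding eventually_at_topological using V y(2) by auto
    ultimately have "(f \<longlongrightarrow> g y) (at y within \<Omega>)"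
      by (rule Lim_transform_eventually)
    then show ?thesis using False nt by (simp add: F_def tendsto_Lim)
  qed
  have "smooth_on (closure \<Omega>) F"
  proof (rule smooth_onI)
    fix x assume "x \<in> closure \<Omega>"
    from ext[OF this] show "\<exists>V g. open V \<and> x \<in> V \<and> smooth_open V g \<and> (\<forall>y\<in>closure \<Omega> \<inter> V. g y = F y)"
      using eq by (metis IntD1 IntD2)
  qed
  then show ?thesis by (auto simp: F_def)
qed

lemma smooth_on_interior_differentiable:
  assumes "smooth_on S f" "open \<Omega>" "\<Omega> \<subseteq> S" "x \<in> \<Omega>"
  shows "f differentiable (at x)"
proof -
  obtain V g where V: "open V" "x \<in> V" "smooth_open V g" "\<forall>y\<in>S \<inter> V. g y = f y"
    using assms(1) subsetD[OF assms(3,4)] by (rule smooth_onE)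
  from smooth_open_differentiable[OF V(3,2)] show ?thesis
    unfolding differentiable_def
    using has_derivative_transform_within_open[of g _ x UNIV "V \<inter> \<Omega>" f] V assms by blast
qed

text \<open>At boundary points \<open>frechet_derivative f (at x)\<close> carries no information, as
  \<open>f\<close> is unconstrained outside the closure; derivatives of local extensions supply the
  boundary values.\<close>

lemma smooth_on_closure_derivative:
  assumes "open \<Omega>" "smooth_on (closure \<Omega>) f"
  shows "\<exists>F. smooth_on (closure \<Omega>) F \<and> (\<forall>x\<in>\<Omega>. F x = frechet_derivative f (at x) v)"
proof (rule smooth_on_closure_extension[OF assms(1)])
  fix x assume "x \<in> closure \<Omega>"
  with assms(2) obtain V g where V: "open V" "x \<in> V" "smooth_open V g"
      "\<forall>y\<in>closure \<Omega> \<inter> V. g y = f y"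
    by (rule smooth_onE)
  have "frechet_derivative g (at y) v = frechet_derivative f (at y) v" if "y \<in> \<Omega> \<inter> V" for y
    using frechet_derivative_transform_within_open[of g y "\<Omega> \<inter> V" f]
      smooth_open_differentiable[OF V(3)] V(1,4) that assms(1) closure_subset[of \<Omega>]
    by (auto simp: open_Int subset_iff)
  with smooth_open_frechet_derivative[OF V(3)] V(1,2)
  show "\<exists>V g. open V \<and> x \<in> V \<and> smooth_open V g \<and>
      (\<forall>y\<in>\<Omega> \<inter> V. g y = frechet_derivative f (at y) v)"
    by blast
qed


section \<open>Hamilton fields and fibre derivatives\<close>

lemma smooth_on_imp_differentiable_within:
  assumes "smooth_on S f" "x \<in> S"
  shows "f differentiable (at x within S)"
proof -
  obtain V g where V: "open V" "x \<in> V" "smooth_open V g" "\<forall>y\<in>S \<inter> V. g y = f y"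
    using assms by (rule smooth_onE)
  have "(g has_derivative frechet_derivative g (at x)) (at x within S)"
    using smooth_open_differentiable[OF V(3,2)]
    by (simp add: frechet_derivative_works[symmetric] has_derivative_at_withinI)
  moreover obtain e where "e > 0" "ball x e \<subseteq> V"
    using V(1,2) openE by blast
  ultimately have "(f has_derivative frechet_derivative g (at x)) (at x within S)"
    using V(4) by (intro has_derivative_transform_within[of g _ x S e f] assms(2))
      (auto simp: subset_iff dist_commute)
  then show ?thesis by (auto simp: differentiable_def)
qed

text \<open>Derivatives within a general set need not be unique, but a fibre direction can be tested
  along a line with fixed base point, which stays inside for small parameters because
  \<open>\<zeta>\<close> is nonzero. Every choice of derivative therefore takes the value
  \<open>c\<close> there.\<close>

lemma frechet_derivative_fibre:
  fixes q :: "'a::euclidean_space \<times> 'a \<Rightarrow> real"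
  assumes "q differentiable (at (z, \<zeta>) within cotangent0 M)" "z \<in> M" "\<zeta> \<noteq> 0"
    and "((\<lambda>s. q (z, \<zeta> + s *\<^sub>R v)) has_real_derivative c) (at 0)"
  shows "frechet_derivative q (at (z, \<zeta>) within cotangent0 M) (0, v) = c"
proof -
  define D where "D = frechet_derivative q (at (z, \<zeta>) within cotangent0 M)"
  define \<gamma> where "\<gamma> s = (z, \<zeta> + s *\<^sub>R v)" for s :: real
  define T where "T = {s. \<zeta> + s *\<^sub>R v \<noteq> 0}"
  have D: "(q has_derivative D) (at (\<gamma> 0) within cotangent0 M)"
    using assms(1) by (simp add: D_def \<gamma>_def frechet_derivative_works[symmetric])
  have "open T" unfolding T_def
    by (intro open_Collect_neq continuous_intros)
  have "0 \<in> T" using assms(3) by (simp add: T_def)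
  have "\<gamma> ` T \<subseteq> cotangent0 M"
    using assms(2) by (auto simp: \<gamma>_def T_def cotangent0_def)
  then have "(q has_derivative D) (at (\<gamma> 0) within \<gamma> ` T)"
    using D has_derivative_subset by blast
  moreover have "(\<gamma> has_derivative (\<lambda>s. (0, s *\<^sub>R v))) (at 0 within T)"
    unfolding \<gamma>_def by (auto intro!: derivative_eq_intros)
  ultimately have "((\<lambda>s. q (\<gamma> s)) has_derivative (\<lambda>s. D (0, s *\<^sub>R v))) (at 0 within T)"
    using has_derivative_in_compose[of \<gamma> _ 0 T q D] by simp
  then have "((\<lambda>s. q (\<gamma> s)) has_derivative (\<lambda>s. D (0, s *\<^sub>R v))) (at 0)"
    using \<open>open T\<close> \<open>0 \<in> T\<close> by (simp add: at_within_open[of 0 T])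
  moreover have "((\<lambda>s. q (\<gamma> s)) has_derivative (*) c) (at 0)"
    using assms(4) by (simp add: \<gamma>_def has_field_derivative_def)
  ultimately have "(\<lambda>s. D (0, s *\<^sub>R v)) = (*) c"
    by (rule has_derivative_unique)
  from fun_cong[OF this, of 1] show ?thesis by (simp add: D_def)
qed

text \<open>Both conditions on the Hamilton field only need its base component to be nonzero, so no
  derivative in the base directions, delicate at the boundary, ever has to be computed.\<close>

lemma real_principal_type_cotangent0I:
  fixes q :: "'a::euclidean_space \<times> 'a \<Rightarrow> real"
  assumes hom: "homogeneous_symbol (cotangent0 M) q" and "v \<in> Basis"
    and der: "\<And>z \<zeta>. z \<in> M \<Longrightarrow> \<zeta> \<noteq> 0 \<Longrightarrow> q (z, \<zeta>) = 0 \<Longrightarrow>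
      \<exists>c. c \<noteq> 0 \<and> ((\<lambda>s. q (z, \<zeta> + s *\<^sub>R v)) has_real_derivative c) (at 0)"
  shows "real_principal_type (cotangent0 M) q"
proof -
  have "fst (hamilton_field (cotangent0 M) q (z, \<zeta>)) \<noteq> 0"
    if "z \<in> M" "\<zeta> \<noteq> 0" "q (z, \<zeta>) = 0" for z \<zeta>
  proof -
    define D where "D = frechet_derivative q (at (z, \<zeta>) within cotangent0 M)"
    obtain c where c: "c \<noteq> 0" "((\<lambda>s. q (z, \<zeta> + s *\<^sub>R v)) has_real_derivative c) (at 0)"
      using der[OF \<open>z \<in> M\<close> \<open>\<zeta> \<noteq> 0\<close> \<open>q (z, \<zeta>) = 0\<close>] by blast
    have "q differentiable (at (z, \<zeta>) within cotangent0 M)"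
      using hom that by (intro smooth_on_imp_differentiable_within)
        (auto simp: homogeneous_symbol_def cotangent0_def)
    then have "D (0, v) = c"
      unfolding D_def by (rule frechet_derivative_fibre[OF _ that(1,2) c(2)])
    \<comment> \<open>The base part of the Hamilton field is the fibre gradient, so this component
      is the fibre derivative along \<open>v\<close>.\<close>
    moreover have "fst (hamilton_field (cotangent0 M) q (z, \<zeta>)) \<bullet> v = D (0, v)"
      using \<open>v \<in> Basis\<close>
      by (simp add: hamilton_field_def Let_def D_def[symmetric] inner_sum_left_Basis)
    ultimately show ?thesis using c(1) by auto
  qed
  then have "hamilton_field (cotangent0 M) q w \<noteq> 0 \<and>
      (\<forall>c. hamilton_field (cotangent0 M) q w \<noteq> c *\<^sub>R (0, snd w))"
    if "w \<in> cotangent0 M" "q w = 0" for w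
    using that by (cases w) (fastforce simp: cotangent0_def)
  then show ?thesis using hom by (simp add: real_principal_type_def)
qed


section \<open>The symbols of elastodynamics\<close>

definition outer_square :: "real^3 \<Rightarrow> real^3^3" where
  "outer_square \<xi> = (\<chi> i j. \<xi> $ i * \<xi> $ j)"

lemma outer_square_scaleR: "outer_square (s *\<^sub>R \<xi>) = s\<^sup>2 *\<^sub>R outer_square \<xi>"
  by (simp add: outer_square_def vec_eq_iff power2_eq_square)

text \<open>Since \<open>outer_square \<xi>\<close> squares to \<open>\<xi> \<bullet> \<xi>\<close>
  times itself, its coefficient in the product is
  \<open>c * (a - b - c * (\<xi> \<bullet> \<xi>))\<close>, zero by assumption.\<close>

lemma rank_one_perturbation_mult:
  fixes \<xi> :: "real^3"
  assumes "b = a - c * (\<xi> \<bullet> \<xi>)"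
  shows "(b *\<^sub>R mat 1 + c *\<^sub>R outer_square \<xi>) ** (a *\<^sub>R mat 1 - c *\<^sub>R outer_square \<xi>)
    = mat (a * b)"
  unfolding assms
  by (simp add: vec_eq_iff forall_3 matrix_matrix_mult_def sum_3 mat_def outer_square_def inner_vec_def)
    (simp add: algebra_simps)

text \<open>For nonzero \<open>\<xi>\<close> the eigenvalue is \<open>a\<close> on the plane
  orthogonal to \<open>\<xi>\<close> and \<open>a - c * (\<xi> \<bullet> \<xi>)\<close> along
  \<open>\<xi>\<close>.\<close>

lemma det_rank_one_perturbation:
  fixes \<xi> :: "real^3"
  shows "det (a *\<^sub>R mat 1 - c *\<^sub>R outer_square \<xi>) = a\<^sup>2 * (a - c * (\<xi> \<bullet> \<xi>))"
  by (simp add: det_3 mat_def outer_square_def inner_vec_def sum_3 power2_eq_square)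
    (simp add: algebra_simps)

lemma complexify_matrix_mult:
  "complexify_matrix (A ** B) = complexify_matrix A ** complexify_matrix B"
  by (simp add: complexify_matrix_def matrix_matrix_mult_def vec_eq_iff)

lemma complexify_matrix_mat: "complexify_matrix (mat a) = mat (complex_of_real a)"
  by (simp add: complexify_matrix_def mat_def vec_eq_iff)

lemma complexify_matrix_scaleR: "complexify_matrix (c *\<^sub>R A) = c *\<^sub>R complexify_matrix A"
  by (simp add: complexify_matrix_def vec_eq_iff) (simp add: scaleR_conv_of_real)

lemma det_complexify_matrix: "det (complexify_matrix A) = complex_of_real (det A)"
  by (simp add: complexify_matrix_def det_def)

locale elastic_medium =
  fixes \<Omega> :: "(real^3) set" and rho lam mu :: "real^3 \<Rightarrow> real" and R :: "real^3 \<Rightarrow> real^3^3"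
  assumes domain: "open \<Omega>"
    and coefficients: "elastic_coefficients \<Omega> rho lam mu R"
    and elliptic: "\<And>x \<xi>. x \<in> closure \<Omega> \<Longrightarrow> \<xi> \<noteq> 0 \<Longrightarrow> mu x * (norm \<xi>)\<^sup>2 + (R x *v \<xi>) \<bullet> \<xi> > 0"
begin

abbreviation phase_space :: "(spacetime \<times> spacetime) set" where
  "phase_space \<equiv> cotangent0 (UNIV \<times> closure \<Omega>)"

section \<open>Polynomial form, smoothness and homogeneity of the symbols\<close>

lemma smooth_coefficients:
  "smooth_on (closure \<Omega>) rho" "smooth_on (closure \<Omega>) lam" "smooth_on (closure \<Omega>) mu"
  "smooth_on (closure \<Omega>) R"
  using coefficients by (auto simp: elastic_coefficients_def)

lemma pos_coefficients:
  assumes "x \<in> closure \<Omega>"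
  shows "rho x > 0" "lam x > 0" "mu x > 0"
  using coefficients assms by (auto simp: elastic_coefficients_def)

lemma q_S_eq:
  "x \<in> closure \<Omega> \<Longrightarrow> q_S rho mu R ((t, x), (\<tau>, \<xi>))
    = rho x * \<tau>\<^sup>2 - (mu x * (\<xi> \<bullet> \<xi>) + (R x *v \<xi>) \<bullet> \<xi>)"
  using pos_coefficients(1)[of x]
  by (simp add: q_S_def form_S_def right_diff_distrib power2_norm_eq_inner)

lemma q_P_eq:
  "x \<in> closure \<Omega> \<Longrightarrow> q_P rho lam mu R ((t, x), (\<tau>, \<xi>))
    = q_S rho mu R ((t, x), (\<tau>, \<xi>)) - (lam x + mu x) * (\<xi> \<bullet> \<xi>)"
  using pos_coefficients(1)[of x]
  by (simp add: q_P_def q_S_eq form_P_def power2_norm_eq_inner field_simps)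

text \<open>The factor \<open>\<xi> \<bullet> \<xi>\<close> in the difference of the two scalar
  symbols absorbs the denominator of \<open>proj\<close>; at \<open>\<xi> = 0\<close> both sides are
  \<open>rho x * \<tau>\<^sup>2\<close> times the identity.\<close>

lemma elastic_symbol_eq:
  assumes "x \<in> closure \<Omega>"
  shows "elastic_symbol rho lam mu R ((t, x), (\<tau>, \<xi>))
    = q_S rho mu R ((t, x), (\<tau>, \<xi>)) *\<^sub>R mat 1 - (lam x + mu x) *\<^sub>R outer_square \<xi>"
proof (cases "\<xi> = 0")
  case True
  moreover have "outer_square 0 = 0"
    by (simp add: outer_square_def vec_eq_iff)
  ultimately show ?thesis
    using assms by (simp add: elastic_symbol_def q_S_eq)
next
  case False
  have "outer_square \<xi> = (\<xi> \<bullet> \<xi>) *\<^sub>R proj \<xi>"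
    using False by (simp add: outer_square_def proj_def vec_eq_iff)
  then show ?thesis
    using assms False by (simp add: elastic_symbol_def q_P_eq algebra_simps)
qed

lemma bounded_linear_position: "bounded_linear (\<lambda>w :: spacetime \<times> spacetime. snd (fst w))"
  and bounded_linear_frequency: "bounded_linear (\<lambda>w :: spacetime \<times> spacetime. fst (snd w))"
  and bounded_linear_wave_vector: "bounded_linear (\<lambda>w :: spacetime \<times> spacetime. snd (snd w) $ i)"
  by (intro bounded_linear_intros bounded_linear_compose[OF bounded_linear_vec_nth])+

lemma smooth_on_phase_space_position:
  "smooth_on (closure \<Omega>) f \<Longrightarrow> smooth_on phase_space (\<lambda>w. f (snd (fst w)))"
  by (rule smooth_on_compose_linear[OF _ bounded_linear_position]) (auto simp: cotangent0_def)

lemma smooth_on_q_S: "smooth_on phase_space (q_S rho mu R)"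
proof (rule smooth_on_cong)
  let ?x = "\<lambda>w :: spacetime \<times> spacetime. snd (fst w)"
    and ?\<tau> = "\<lambda>w :: spacetime \<times> spacetime. fst (snd w)"
    and ?\<xi> = "\<lambda>w :: spacetime \<times> spacetime. snd (snd w)"
  \<comment> \<open>Scalar products are spelled out in coordinates so that the rules for sums,
    products and linear functions apply.\<close>
  show "smooth_on phase_space (\<lambda>w. rho (?x w) * (?\<tau> w * ?\<tau> w) -
      (mu (?x w) * (\<Sum>i\<in>UNIV. ?\<xi> w $ i * ?\<xi> w $ i)
        + (\<Sum>i\<in>UNIV. (\<Sum>j\<in>UNIV. R (?x w) $ i $ j * ?\<xi> w $ j) * ?\<xi> w $ i)))"
    by (intro smooth_on_add smooth_on_diff smooth_on_mult smooth_on_sum smooth_on_phase_space_position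
        smooth_coefficients smooth_on_vec_nth smooth_on_linear bounded_linear_frequency
        bounded_linear_wave_vector)
qed (auto simp: cotangent0_def q_S_eq inner_vec_def matrix_vector_mult_def power2_eq_square)

lemma smooth_on_q_P: "smooth_on phase_space (q_P rho lam mu R)"
proof (rule smooth_on_cong)
  let ?x = "\<lambda>w :: spacetime \<times> spacetime. snd (fst w)"
    and ?\<xi> = "\<lambda>w :: spacetime \<times> spacetime. snd (snd w)"
  show "smooth_on phase_space (\<lambda>w. q_S rho mu R w -
      (lam (?x w) + mu (?x w)) * (\<Sum>i\<in>UNIV. ?\<xi> w $ i * ?\<xi> w $ i))"
    by (intro smooth_on_add smooth_on_diff smooth_on_mult smooth_on_sum smooth_on_phase_space_position
        smooth_coefficients smooth_on_q_S smooth_on_linear bounded_linear_wave_vector)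
qed (auto simp: cotangent0_def q_P_eq inner_vec_def)

lemma quadratic_scale:
  "(norm (s *\<^sub>R \<xi>))\<^sup>2 = s\<^sup>2 * (norm \<xi>)\<^sup>2" "(A *v (s *\<^sub>R \<xi>)) \<bullet> (s *\<^sub>R \<xi>) = s\<^sup>2 * ((A *v \<xi>) \<bullet> \<xi>)"
  for \<xi> :: "real^3"
  by (simp_all add: power_mult_distrib matrix_vector_mult_scaleR power2_eq_square)

lemma form_S_scale: "form_S rho mu R x (s *\<^sub>R \<xi>) = s\<^sup>2 * form_S rho mu R x \<xi>"
  unfolding form_S_def quadratic_scale by (simp add: distrib_left mult.left_commute)

lemma form_P_scale: "form_P rho lam mu R x (s *\<^sub>R \<xi>) = s\<^sup>2 * form_P rho lam mu R x \<xi>"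
  unfolding form_P_def quadratic_scale by (simp add: distrib_left mult.left_commute)

lemma q_S_scale: "q_S rho mu R ((t, x), s *\<^sub>R \<zeta>) = s\<^sup>2 * q_S rho mu R ((t, x), \<zeta>)"
  by (cases \<zeta>) (simp add: q_S_def form_S_scale power_mult_distrib right_diff_distrib mult.left_commute)

lemma q_P_scale: "q_P rho lam mu R ((t, x), s *\<^sub>R \<zeta>) = s\<^sup>2 * q_P rho lam mu R ((t, x), \<zeta>)"
  by (cases \<zeta>) (simp add: q_P_def form_P_scale power_mult_distrib right_diff_distrib mult.left_commute)

lemma homogeneous_q_S: "homogeneous_symbol phase_space (q_S rho mu R)"
  unfolding homogeneous_symbol_def
  \<comment> \<open>The degree is 2. The scaled covector stays unsplit so that
    \<open>q_S_scale\<close> matches it as a whole.\<close>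
  by (intro conjI smooth_on_q_S exI[of _ 2]) (auto simp: q_S_scale cotangent0_def simp del: scaleR_Pair)

lemma homogeneous_q_P: "homogeneous_symbol phase_space (q_P rho lam mu R)"
  unfolding homogeneous_symbol_def
  by (intro conjI smooth_on_q_P exI[of _ 2]) (auto simp: q_P_scale cotangent0_def simp del: scaleR_Pair)

lemma homogeneous_q_S_q_P:
  "homogeneous_symbol phase_space (\<lambda>w. q_S rho mu R w * q_P rho lam mu R w)"
  unfolding homogeneous_symbol_def
  by (intro conjI smooth_on_mult smooth_on_q_S smooth_on_q_P exI[of _ 4])
    (auto simp: q_S_scale q_P_scale cotangent0_def power2_eq_square power4_eq_xxxx simp del: scaleR_Pair)

section \<open>Positivity of the forms and real principal type of the scalar symbols\<close>

lemma form_positivity: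
  assumes "x \<in> closure \<Omega>"
  shows "\<xi> \<noteq> 0 \<Longrightarrow> form_S rho mu R x \<xi> > 0" "\<xi> \<noteq> 0 \<Longrightarrow> form_P rho lam mu R x \<xi> > form_S rho mu R x \<xi>"
    "form_S rho mu R x 0 = 0" "form_P rho lam mu R x 0 = 0"
proof -
  show "\<xi> \<noteq> 0 \<Longrightarrow> form_S rho mu R x \<xi> > 0"
    using elliptic[OF assms] pos_coefficients[OF assms] by (simp add: form_S_def)
  show "form_P rho lam mu R x \<xi> > form_S rho mu R x \<xi>" if "\<xi> \<noteq> 0"
  proof -
    \<comment> \<open>The margin is \<open>lam x + mu x > 0\<close>.\<close>
    have "mu x * (norm \<xi>)\<^sup>2 < (lam x + 2 * mu x) * (norm \<xi>)\<^sup>2"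
      using pos_coefficients[OF assms] that by (intro mult_strict_right_mono) auto
    then show ?thesis
      using pos_coefficients[OF assms] by (simp add: form_S_def form_P_def divide_strict_right_mono)
  qed
qed (simp_all add: form_S_def form_P_def)

lemma q_S_derivative:
  "((\<lambda>s. q_S rho mu R ((t, x), (\<tau>, \<xi>) + s *\<^sub>R (1, 0))) has_real_derivative 2 * rho x * \<tau>) (at 0)"
  by (auto simp: q_S_def intro!: derivative_eq_intros)

lemma q_P_derivative:
  "((\<lambda>s. q_P rho lam mu R ((t, x), (\<tau>, \<xi>) + s *\<^sub>R (1, 0))) has_real_derivative 2 * rho x * \<tau>) (at 0)"
  by (auto simp: q_P_def intro!: derivative_eq_intros)

text \<open>The sum is the factor left in the frequency derivative
  \<open>2 * rho x * \<tau> * (q_S + q_P)\<close> of the product, which must not vanish where either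
  symbol does.\<close>

lemma characteristic_frequency:
  assumes "x \<in> closure \<Omega>" "(\<tau>, \<xi>) \<noteq> 0"
    and "q_S rho mu R ((t, x), (\<tau>, \<xi>)) = 0 \<or> q_P rho lam mu R ((t, x), (\<tau>, \<xi>)) = 0"
  shows "\<tau> \<noteq> 0" "q_S rho mu R ((t, x), (\<tau>, \<xi>)) + q_P rho lam mu R ((t, x), (\<tau>, \<xi>)) \<noteq> 0"
proof -
  note pos = pos_coefficients[OF assms(1)] and form = form_positivity[OF assms(1)]
  \<comment> \<open>For \<open>\<xi> = 0\<close> either equation reads
    \<open>rho x * \<tau>\<^sup>2 = 0\<close>, which would make the whole covector zero.\<close>
  have "\<xi> \<noteq> 0"
    using assms(2,3) pos form(3,4) by (auto simp: q_S_def q_P_def zero_prod_def)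
  then show "\<tau> \<noteq> 0"
    using assms(3) pos form(1,2)[of \<xi>] by (auto simp: q_S_def q_P_def)
  \<comment> \<open>This quantity is \<open>q_S - q_P\<close>; once one symbol vanishes, the sum
    equals it up to sign.\<close>
  have "(lam x + mu x) * (\<xi> \<bullet> \<xi>) \<noteq> 0"
    using pos \<open>\<xi> \<noteq> 0\<close> by simp
  then show "q_S rho mu R ((t, x), (\<tau>, \<xi>)) + q_P rho lam mu R ((t, x), (\<tau>, \<xi>)) \<noteq> 0"
    using assms(3) by (auto simp: q_P_eq[OF assms(1)])
qed

lemma time_Basis: "(1, 0) \<in> (Basis :: spacetime set)"
  by (simp add: Basis_prod_def)

lemma real_principal_type_q_S: "real_principal_type phase_space (q_S rho mu R)"
proof (rule real_principal_type_cotangent0I[OF homogeneous_q_S time_Basis])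
  fix z \<zeta> :: spacetime
  assume *: "z \<in> UNIV \<times> closure \<Omega>" "\<zeta> \<noteq> 0" "q_S rho mu R (z, \<zeta>) = 0"
  obtain t x \<tau> \<xi> where "z = (t, x)" "\<zeta> = (\<tau>, \<xi>)" by (cases z, cases \<zeta>)
  with * show "\<exists>c. c \<noteq> 0 \<and> ((\<lambda>s. q_S rho mu R (z, \<zeta> + s *\<^sub>R (1, 0))) has_real_derivative c) (at 0)"
    using characteristic_frequency(1)[of x \<tau> \<xi> t] pos_coefficients(1)[of x]
    by (intro exI[of _ "2 * rho x * \<tau>"]) (auto simp del: scaleR_Pair intro!: q_S_derivative)
qed

lemma real_principal_type_q_P: "real_principal_type phase_space (q_P rho lam mu R)"
proof (rule real_principal_type_cotangent0I[OF homogeneous_q_P time_Basis])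
  fix z \<zeta> :: spacetime
  assume *: "z \<in> UNIV \<times> closure \<Omega>" "\<zeta> \<noteq> 0" "q_P rho lam mu R (z, \<zeta>) = 0"
  obtain t x \<tau> \<xi> where "z = (t, x)" "\<zeta> = (\<tau>, \<xi>)" by (cases z, cases \<zeta>)
  with * show "\<exists>c. c \<noteq> 0 \<and> ((\<lambda>s. q_P rho lam mu R (z, \<zeta> + s *\<^sub>R (1, 0))) has_real_derivative c) (at 0)"
    using characteristic_frequency(1)[of x \<tau> \<xi> t] pos_coefficients(1)[of x]
    by (intro exI[of _ "2 * rho x * \<tau>"]) (auto simp del: scaleR_Pair intro!: q_P_derivative)
qed

lemma real_principal_type_q_S_q_P:
  "real_principal_type phase_space (\<lambda>w. q_S rho mu R w * q_P rho lam mu R w)"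
proof (rule real_principal_type_cotangent0I[OF homogeneous_q_S_q_P time_Basis])
  fix z \<zeta> :: spacetime
  assume *: "z \<in> UNIV \<times> closure \<Omega>" "\<zeta> \<noteq> 0" "q_S rho mu R (z, \<zeta>) * q_P rho lam mu R (z, \<zeta>) = 0"
  obtain t x \<tau> \<xi> where z: "z = (t, x)" "\<zeta> = (\<tau>, \<xi>)" by (cases z, cases \<zeta>)
  \<comment> \<open>Product rule, both factors having frequency derivative
    \<open>2 * rho x * \<tau>\<close>.\<close>
  let ?c = "2 * rho x * \<tau> * (q_S rho mu R (z, \<zeta>) + q_P rho lam mu R (z, \<zeta>))"
  have "((\<lambda>s. q_S rho mu R (z, \<zeta> + s *\<^sub>R (1, 0)) * q_P rho lam mu R (z, \<zeta> + s *\<^sub>R (1, 0)))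
      has_real_derivative ?c) (at 0)"
    using DERIV_mult[OF q_S_derivative[of t x \<tau> \<xi>] q_P_derivative[of t x \<tau> \<xi>]]
    by (simp add: z algebra_simps)
  moreover have "?c \<noteq> 0"
    using * characteristic_frequency[of x \<tau> \<xi> t] pos_coefficients(1)[of x] by (auto simp: z)
  ultimately show "\<exists>c. c \<noteq> 0 \<and> ((\<lambda>s. q_S rho mu R (z, \<zeta> + s *\<^sub>R (1, 0)) *
      q_P rho lam mu R (z, \<zeta> + s *\<^sub>R (1, 0))) has_real_derivative c) (at 0)"
    by blast
qed

text \<open>The adjugate-like factor \<open>q\<^sub>P (1 - \<pi>) + q\<^sub>S \<pi>\<close>, rewritten so that its smoothness at \<open>\<xi> = 0\<close> is
  visible.\<close>

definition cofactor_symbol :: "spacetime \<times> spacetime \<Rightarrow> real^3^3" where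
  "cofactor_symbol = (\<lambda>((t, x), (\<tau>, \<xi>)).
     q_P rho lam mu R ((t, x), (\<tau>, \<xi>)) *\<^sub>R mat 1 + (lam x + mu x) *\<^sub>R outer_square \<xi>)"

lemma homogeneous_cofactor_symbol:
  "homogeneous_symbol phase_space (\<lambda>w. complexify_matrix (cofactor_symbol w))"
  unfolding homogeneous_symbol_def
proof
  let ?x = "\<lambda>w :: spacetime \<times> spacetime. snd (fst w)"
    and ?\<xi> = "\<lambda>w :: spacetime \<times> spacetime. snd (snd w)"
  have "smooth_on phase_space (\<lambda>w. q_P rho lam mu R w * (if i = j then 1 else 0)
      + (lam (?x w) + mu (?x w)) * (?\<xi> w $ i * ?\<xi> w $ j))" for i j
    by (intro smooth_on_add smooth_on_mult smooth_on_phase_space_position smooth_on_const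
        smooth_coefficients smooth_on_q_P smooth_on_linear bounded_linear_wave_vector)
  then have "smooth_on phase_space (\<lambda>w. \<chi> i j. complex_of_real
      (q_P rho lam mu R w * (if i = j then 1 else 0) + (lam (?x w) + mu (?x w)) * (?\<xi> w $ i * ?\<xi> w $ j)))"
    by (intro smooth_on_vec_lambda bounded_linear.smooth_on_compose[OF bounded_linear_of_real])
  then show "smooth_on phase_space (\<lambda>w. complexify_matrix (cofactor_symbol w))"
    by (rule smooth_on_cong[rotated])
      (auto simp: complexify_matrix_def cofactor_symbol_def outer_square_def mat_def vec_eq_iff)
  show "\<exists>m. \<forall>(z, \<zeta>)\<in>phase_space. \<forall>s>0. complexify_matrix (cofactor_symbol (z, s *\<^sub>R \<zeta>))
      = (s powr m) *\<^sub>R complexify_matrix (cofactor_symbol (z, \<zeta>))"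
  proof (intro exI[of _ 2] ballI, clarify)
    fix t x \<tau> \<xi> and s :: real
    assume "s > 0"
    moreover have "cofactor_symbol ((t, x), s *\<^sub>R (\<tau>, \<xi>)) = s\<^sup>2 *\<^sub>R cofactor_symbol ((t, x), \<tau>, \<xi>)"
      using q_P_scale[of t x s "(\<tau>, \<xi>)"]
      by (simp add: cofactor_symbol_def outer_square_scaleR scaleR_add_right mult.commute)
    ultimately show "complexify_matrix (cofactor_symbol ((t, x), s *\<^sub>R (\<tau>, \<xi>)))
        = (s powr 2) *\<^sub>R complexify_matrix (cofactor_symbol ((t, x), \<tau>, \<xi>))"
      by (simp add: complexify_matrix_scaleR)
  qed
qed

text \<open>The factorization is global, so the whole phase space serves as conic neighbourhood of
  every point. The scalar symbol is \<open>q_S q_P\<close> rather than the determinant, whose double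
  factor \<open>q_S\<^sup>2\<close> would make the Hamilton field vanish on
  \<open>q_S = 0\<close>.\<close>

lemma real_principal_type_elastic:
  "real_principal_type_system (UNIV \<times> closure \<Omega>)
    (\<lambda>w. complexify_matrix (elastic_symbol rho lam mu R w))"
  unfolding real_principal_type_system_def
proof
  fix w assume w: "w \<in> phase_space"
  let ?q = "\<lambda>w. q_S rho mu R w * q_P rho lam mu R w"
  have "conic phase_space" by (auto simp: conic_def cotangent0_def)
  moreover have "complexify_matrix (cofactor_symbol v) ** complexify_matrix (elastic_symbol rho lam mu R v)
      = mat (complex_of_real (?q v))"
    and "det (complexify_matrix (elastic_symbol rho lam mu R v)) = 0 \<longleftrightarrow> ?q v = 0"
    if "v \<in> phase_space" for v
  proof -
    obtain t x \<tau> \<xi> where v: "v = ((t, x), (\<tau>, \<xi>))" by (metis surj_pair)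
    then have x: "x \<in> closure \<Omega>" using that by (simp add: cotangent0_def)
    \<comment> \<open>The rank-one identity with \<open>a\<close>, \<open>b\<close>,
      \<open>c\<close> equal to \<open>q_S\<close>, \<open>q_P\<close> and
      \<open>lam x + mu x\<close>.\<close>
    show "complexify_matrix (cofactor_symbol v) ** complexify_matrix (elastic_symbol rho lam mu R v)
      = mat (complex_of_real (?q v))"
      unfolding v cofactor_symbol_def prod.case elastic_symbol_eq[OF x] complexify_matrix_mult[symmetric]
        rank_one_perturbation_mult[OF q_P_eq[OF x]] complexify_matrix_mat ..
    \<comment> \<open>The determinant is \<open>q_S\<^sup>2 q_P\<close>, with the same zeros as
      \<open>q_S q_P\<close>.\<close>
    show "det (complexify_matrix (elastic_symbol rho lam mu R v)) = 0 \<longleftrightarrow> ?q v = 0"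
      unfolding v elastic_symbol_eq[OF x] det_complexify_matrix det_rank_one_perturbation
        q_P_eq[OF x, symmetric] by simp
  qed
  ultimately show "\<exists>U q p'. w \<in> U \<and> openin (top_of_set phase_space) U \<and> conic U \<and>
      real_principal_type U q \<and> homogeneous_symbol U (p' :: _ \<Rightarrow> complex^3^3) \<and>
      (\<forall>v\<in>U. p' v ** complexify_matrix (elastic_symbol rho lam mu R v) = mat (complex_of_real (q v))) \<and>
      (\<forall>v\<in>U. det (complexify_matrix (elastic_symbol rho lam mu R v)) = 0 \<longleftrightarrow> q v = 0)"
    using w real_principal_type_q_S_q_P homogeneous_cofactor_symbol
    by (intro exI[of _ phase_space] exI[of _ ?q]
        exI[of _ "\<lambda>w. complexify_matrix (cofactor_symbol w)"]) auto
qed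

end


section \<open>The principal symbol\<close>

lemma sum_words_2:
  assumes "finite A"
  shows "(\<Sum>bs | set bs \<subseteq> A \<and> length bs = 2. f bs) = (\<Sum>b\<in>A. \<Sum>c\<in>A. f [b, c])"
proof -
  have "{bs. set bs \<subseteq> A \<and> length bs = 2} = (\<lambda>(b, c). [b, c]) ` (A \<times> A)"
    by (auto simp: length_Suc_conv numeral_2_eq_2 image_iff)
  moreover have "inj_on (\<lambda>(b, c). [b, c]) (A \<times> A)"
    by (auto simp: inj_on_def)
  ultimately show ?thesis
    by (simp add: sum.reindex sum.cartesian_product case_prod_unfold)
qed

lemma sum_words_le_2:
  assumes "finite A"
  shows "(\<Sum>bs | set bs \<subseteq> A \<and> length bs \<le> 2. f bs)
    = f [] + (\<Sum>b\<in>A. f [b]) + (\<Sum>b\<in>A. \<Sum>c\<in>A. f [b, c])"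
proof -
  let ?W = "\<lambda>n. {bs. set bs \<subseteq> A \<and> length bs = n}"
  have "{bs. set bs \<subseteq> A \<and> length bs \<le> 2} = insert [] ((\<lambda>b. [b]) ` A \<union> ?W 2)"
    by (auto simp: le_Suc_eq numeral_2_eq_2 length_Suc_conv image_iff)
  moreover have "finite (?W 2)" using assms by (rule finite_lists_length_eq)
  moreover have "(\<lambda>b. [b]) ` A \<inter> ?W 2 = {}" "[] \<notin> (\<lambda>b. [b]) ` A \<union> ?W 2" by auto
  ultimately have "(\<Sum>bs | set bs \<subseteq> A \<and> length bs \<le> 2. f bs)
      = f [] + (sum f ((\<lambda>b. [b]) ` A) + sum f (?W 2))"
    using assms by (simp add: sum.union_disjoint)
  also have "sum f ((\<lambda>b. [b]) ` A) = (\<Sum>b\<in>A. f [b])"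
    by (simp add: sum.reindex inj_on_def)
  finally show ?thesis by (simp add: sum_words_2[OF assms] add.assoc)
qed

lemma sum_Basis_spacetime:
  fixes f :: "spacetime \<Rightarrow> 'b::comm_monoid_add"
  shows "(\<Sum>b\<in>Basis. f b) = f (1, 0) + (\<Sum>j\<in>UNIV. f (0, axis j 1))"
proof -
  let ?e = "\<lambda>j. (0, axis j 1) :: spacetime"
  have Basis: "(Basis :: spacetime set) = insert (1, 0) (range ?e)"
    by (auto simp: Basis_prod_def Basis_vec_def)
  have inj: "inj ?e"
    by (auto simp: inj_on_def axis_eq_axis)
  have "sum f Basis = f (1, 0) + sum f (range ?e)"
    unfolding Basis by (rule sum.insert) auto
  also have "sum f (range ?e) = (\<Sum>j\<in>UNIV. f (?e j))"
    using inj by (subst sum.reindex) simp_all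
  finally show ?thesis .
qed

text \<open>Coefficients of a second order operator are indexed by basis pairs; their sum weighted
  by the covector is the value of the form at that covector.\<close>

lemma sum_Basis_bilinear:
  fixes B :: "'a::euclidean_space \<Rightarrow> 'a \<Rightarrow> real"
  assumes "bilinear B"
  shows "(\<Sum>b\<in>Basis. \<Sum>c\<in>Basis. (\<zeta> \<bullet> b) * (\<zeta> \<bullet> c) * B b c) = B \<zeta> \<zeta>"
proof -
  have "B \<zeta> \<zeta> = B (\<Sum>b\<in>Basis. (\<zeta> \<bullet> b) *\<^sub>R b) (\<Sum>b\<in>Basis. (\<zeta> \<bullet> b) *\<^sub>R b)"
    by (simp add: euclidean_representation)
  also have "\<dots> = (\<Sum>b\<in>Basis. \<Sum>c\<in>Basis. (\<zeta> \<bullet> b) * (\<zeta> \<bullet> c) * B b c)"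
    by (simp add: bilinear_sum[OF assms] sum.cartesian_product case_prod_unfold
        bilinear_lmul[OF assms] bilinear_rmul[OF assms] algebra_simps)
  finally show ?thesis ..
qed

section \<open>Partial derivatives and composition with linear maps\<close>

lemma partial_time_derivative:
  assumes "w differentiable (at (s, y))"
  shows "((\<lambda>r. w (r, y)) has_vector_derivative frechet_derivative w (at (s, y)) (1, 0)) (at s)"
proof -
  let ?D = "frechet_derivative w (at (s, y))"
  have D: "(w has_derivative ?D) (at (s, y))"
    using assms by (simp add: frechet_derivative_works[symmetric])
  have "((\<lambda>r. (r, y)) has_derivative (\<lambda>h. (h, 0))) (at s)"
    by (auto intro!: derivative_eq_intros)
  from has_derivative_compose[OF this D]
  have "((\<lambda>r. w (r, y)) has_derivative (\<lambda>h. ?D (h, 0))) (at s)" .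
  moreover have "(\<lambda>h. ?D (h, 0)) = (\<lambda>h :: real. h *\<^sub>R ?D (1, 0))"
  proof
    show "?D (h, 0) = h *\<^sub>R ?D (1, 0)" for h :: real
      using linear_scale[OF has_derivative_linear[OF D], of h "(1, 0)"] by simp
  qed
  ultimately show ?thesis by (simp only: has_vector_derivative_def)
qed

lemma partial_space_derivative:
  assumes "w differentiable (at (s, y))"
  shows "((\<lambda>y. w (s, y)) has_derivative (\<lambda>h. frechet_derivative w (at (s, y)) (0, h))) (at y)"
proof -
  have D: "(w has_derivative frechet_derivative w (at (s, y))) (at (s, y))"
    using assms by (simp add: frechet_derivative_works[symmetric])
  have "((\<lambda>y. (s, y)) has_derivative (\<lambda>h. (0, h))) (at y)"
    by (auto intro!: derivative_eq_intros)
  from has_derivative_compose[OF this D] show ?thesis .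
qed

lemma has_derivative_linear_compose:
  assumes "bounded_linear L" "u differentiable (at z)"
  shows "((\<lambda>z. L (u z)) has_derivative (\<lambda>h. L (frechet_derivative u (at z) h))) (at z)"
  by (rule bounded_linear.has_derivative[OF assms(1) frechet_derivative_works[THEN iffD1, OF assms(2)]])

lemma frechet_derivative_linear_compose:
  assumes "bounded_linear L" "u differentiable (at z)"
  shows "frechet_derivative (\<lambda>z. L (u z)) (at z) b = L (frechet_derivative u (at z) b)"
  by (rule fun_cong[OF frechet_derivative_at[OF has_derivative_linear_compose[OF assms]], symmetric])

text \<open>The first order formula holds at points of \<open>X\<close>, so the inner function is
  exchanged by locality before differentiating again.\<close>

lemma frechet_derivative2_linear_compose:
  assumes "bounded_linear L" "open X" "smooth_open X u" "z \<in> X"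
  shows "frechet_derivative (\<lambda>z. frechet_derivative (\<lambda>z. L (u z)) (at z) c) (at z) b
    = L (frechet_derivative (\<lambda>z. frechet_derivative u (at z) c) (at z) b)"
proof -
  have "(\<lambda>z. frechet_derivative u (at z) c) differentiable (at z)"
    by (rule smooth_open_differentiable[OF smooth_open_frechet_derivative[OF assms(3)] assms(4)])
  from has_derivative_linear_compose[OF assms(1) this]
  have "((\<lambda>z. frechet_derivative (\<lambda>z. L (u z)) (at z) c) has_derivative
      (\<lambda>h. L (frechet_derivative (\<lambda>z. frechet_derivative u (at z) c) (at z) h))) (at z)"
    by (rule has_derivative_transform_within_open[OF _ assms(2,4)])
      (rule frechet_derivative_linear_compose[OF assms(1) smooth_open_differentiable[OF assms(3)], symmetric])
  from fun_cong[OF frechet_derivative_at[OF this], of b] show ?thesis by (rule sym)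
qed

lemma smooth_open_linear_compose:
  "bounded_linear L \<Longrightarrow> open X \<Longrightarrow> smooth_open X u \<Longrightarrow> smooth_open X (\<lambda>z. L (u z))"
  by (simp add: smooth_open_def bounded_linear.Ck_open_compose)

text \<open>Serves for componentwise real and imaginary parts and for multiplication by a complex
  scalar.\<close>

lemma bounded_linear_vec_lambda:
  fixes f :: "'a::euclidean_space \<Rightarrow> 'b::euclidean_space"
  assumes "bounded_linear f"
  shows "bounded_linear (\<lambda>v :: 'a^'n. \<chi> j. f (v $ j))"
proof -
  interpret bounded_linear f by fact
  show ?thesis
    unfolding linear_conv_bounded_linear[symmetric]
    by (rule linearI) (simp_all add: vec_eq_iff add scaleR)
qed

text \<open>A bilinear form in \<open>b\<close> and \<open>c\<close> whose diagonal is the symbol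
  matrix. The argument order follows that of differentiation, \<open>b\<close> outermost, so that
  its terms match those of the divergence of the stress.\<close>

definition second_order_coeff :: "real \<Rightarrow> real \<Rightarrow> real \<Rightarrow> real^3^3 \<Rightarrow> spacetime \<Rightarrow> spacetime \<Rightarrow>
    3 \<Rightarrow> 3 \<Rightarrow> real" where
  "second_order_coeff r l m S b c i k =
     (r * fst b * fst c - m * (snd b \<bullet> snd c) - (S *v snd b) \<bullet> snd c) * (if i = k then 1 else 0)
     - (l * (snd b $ i * snd c $ k) + m * (snd c $ i * snd b $ k))"

text \<open>The arguments \<open>dl\<close> and \<open>dm\<close> are the gradients of the Lame coefficients.\<close>

definition first_order_coeff :: "(3 \<Rightarrow> real) \<Rightarrow> (3 \<Rightarrow> real) \<Rightarrow> spacetime \<Rightarrow> 3 \<Rightarrow> 3 \<Rightarrow> real" where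
  "first_order_coeff dl dm b i k =
     dl i * snd b $ k + (\<Sum>j\<in>UNIV. dm j * snd b $ j) * (if i = k then 1 else 0) + dm k * snd b $ i"

lemma bilinear_second_order_coeff: "bilinear (\<lambda>b c. second_order_coeff r l m S b c i k)"
  unfolding bilinear_def
  by (intro conjI allI linearI)
    (simp_all add: second_order_coeff_def matrix_vector_right_distrib matrix_vector_mult_scaleR
      inner_simps algebra_simps)

lemma axis_nth_if: "axis j (1::real) $ i = (if i = j then 1 else 0)"
  by (simp add: axis_def)

text \<open>With \<open>H b c k\<close> read as the derivative of component \<open>k\<close> along
  \<open>c\<close> and then \<open>b\<close>, the right side is minus the second order part of the
  operator.\<close>

lemma second_order_sum:
  fixes H :: "spacetime \<Rightarrow> spacetime \<Rightarrow> 3 \<Rightarrow> real"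
  shows "(\<Sum>b\<in>Basis. \<Sum>c\<in>Basis. \<Sum>k\<in>UNIV. second_order_coeff r l m S b c i k * H b c k)
    = r * H (1, 0) (1, 0) i - (\<Sum>j\<in>UNIV. (\<Sum>l\<in>UNIV. H (0, axis j 1) (0, axis l 1) i * S $ l $ j)
      + l * (if i = j then \<Sum>k\<in>UNIV. H (0, axis j 1) (0, axis k 1) k else 0)
      + m * (H (0, axis j 1) (0, axis j 1) i + H (0, axis j 1) (0, axis i 1) j))"
  using exhaust_3[of i] by (elim disjE)
    (simp_all add: sum_Basis_spacetime second_order_coeff_def sum_3 inner_axis_axis
      matrix_vector_mult_basis column_def inner_axis axis_nth_if algebra_simps)

text \<open>With \<open>G b k\<close> read as a first derivative, the right side collects the terms
  where the divergence falls on a Lame coefficient.\<close>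

lemma first_order_sum:
  fixes G :: "spacetime \<Rightarrow> 3 \<Rightarrow> real"
  shows "(\<Sum>b\<in>Basis. \<Sum>k\<in>UNIV. first_order_coeff dl dm b i k * G b k)
    = (\<Sum>j\<in>UNIV. (if i = j then dl j * (\<Sum>k\<in>UNIV. G (0, axis k 1) k) else 0)
      + dm j * (G (0, axis j 1) i + G (0, axis i 1) j))"
  using exhaust_3[of i] by (elim disjE)
    (simp_all add: sum_Basis_spacetime first_order_coeff_def sum_3 axis_nth_if algebra_simps)

section \<open>Expansion of the elastic operator into partial derivatives\<close>

context elastic_medium
begin

abbreviation spacetime_domain :: "spacetime set" where
  "spacetime_domain \<equiv> UNIV \<times> \<Omega>"

lemma open_spacetime_domain: "open spacetime_domain"
  by (simp add: open_Times domain)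

text \<open>After the product rule, the derivatives of \<open>R\<close> assemble into row
  divergences of \<open>R\<close>, which vanish in \<open>\<Omega>\<close>. This also removes the
  inhomogeneous term coming from \<open>R\<close> alone.\<close>

lemma elastic_op_expansion:
  assumes v: "smooth_open spacetime_domain v" and x: "x \<in> \<Omega>"
  shows "elastic_op rho lam mu R v (t, x) $ i =
    - (\<Sum>b\<in>Basis. \<Sum>c\<in>Basis. \<Sum>k\<in>UNIV. second_order_coeff (rho x) (lam x) (mu x) (R x) b c i k *
        frechet_derivative (\<lambda>z. frechet_derivative v (at z) c) (at (t, x)) b $ k)
    + (\<Sum>b\<in>Basis. \<Sum>k\<in>UNIV. first_order_coeff (\<lambda>j. frechet_derivative lam (at x) (axis j 1))
        (\<lambda>j. frechet_derivative mu (at x) (axis j 1)) b i k * frechet_derivative v (at (t, x)) b $ k)"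
proof -
  define d where "d b z = frechet_derivative v (at z) b" for b z
  define dd where "dd b c = frechet_derivative (d c) (at (t, x)) b" for b c
  let ?e = "\<lambda>j::3. (0::real, axis j (1::real))"
  have v_diff: "v differentiable (at (s, y))" if "y \<in> \<Omega>" for s y
    using smooth_open_differentiable[OF v] that by simp
  have d_diff: "d b differentiable (at (s, y))" if "y \<in> \<Omega>" for b s y
    unfolding d_def[abs_def]
    using smooth_open_differentiable[OF smooth_open_frechet_derivative[OF v]] that by simp
  have time: "vector_derivative (\<lambda>s. vector_derivative (\<lambda>r. v (r, x)) (at s)) (at t)
      = dd (1, 0) (1, 0)"
  proof -
    have "vector_derivative (\<lambda>r. v (r, x)) (at s) = d (1, 0) (s, x)" for s
      unfolding d_def by (rule vector_derivative_at[OF partial_time_derivative[OF v_diff[OF x]]])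
    then show ?thesis
      by (simp add: dd_def vector_derivative_at[OF partial_time_derivative[OF d_diff[OF x]]])
  qed
  have jac: "jacobian (\<lambda>y. v (t, y)) (at y) $ k $ j = d (?e j) (t, y) $ k" if "y \<in> \<Omega>" for y k j
    using frechet_derivative_at[OF partial_space_derivative[OF v_diff[OF that, of t]], symmetric]
    by (simp add: jacobian_def matrix_def d_def)
  \<comment> \<open>The stress component \<open>(i, j)\<close> with jacobian entries replaced by
    spacetime derivatives of \<open>v\<close>; the two agree on the open set
    \<open>\<Omega>\<close>, so they have the same derivatives there.\<close>
  define \<sigma> where "\<sigma> j y = R y $ i $ j + (\<Sum>l\<in>UNIV. d (?e l) (t, y) $ i * R y $ l $ j)
      + lam y * (if i = j then \<Sum>k\<in>UNIV. d (?e k) (t, y) $ k else 0)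
      + mu y * (d (?e j) (t, y) $ i + d (?e i) (t, y) $ j)" for j y
  have stress: "stress lam mu R (\<lambda>y. v (t, y)) y $ i $ j = \<sigma> j y" if "y \<in> \<Omega>" for y j
    by (simp add: stress_def strain_def \<sigma>_def jac[OF that] matrix_matrix_mult_def transpose_def
        trace_def mat_def distrib_left)
  note coeff_diff = smooth_coefficients[THEN smooth_on_interior_differentiable, OF domain closure_subset x]
  have R_diff: "(\<lambda>y. R y $ p $ q) differentiable (at x)" for p q
    by (intro smooth_on_interior_differentiable[OF _ domain closure_subset x] smooth_on_vec_nth
        smooth_coefficients)
  define R' where "R' p q = frechet_derivative (\<lambda>y. R y $ p $ q) (at x)" for p q
  have lam': "(lam has_derivative frechet_derivative lam (at x)) (at x)"
    and mu': "(mu has_derivative frechet_derivative mu (at x)) (at x)"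
    and R': "((\<lambda>y. R y $ p $ q) has_derivative R' p q) (at x)" for p q
    using coeff_diff R_diff[of p q] by (simp_all add: R'_def frechet_derivative_works[symmetric])
  have d': "((\<lambda>y. d b (t, y) $ k) has_derivative
      (\<lambda>h. frechet_derivative (d b) (at (t, x)) (0, h) $ k)) (at x)" for b k
    by (rule bounded_linear.has_derivative[OF bounded_linear_vec_nth
          partial_space_derivative[OF d_diff[OF x]]])
  have div_R: "(\<Sum>j\<in>UNIV. R' p j (axis j 1)) = 0" for p
  proof -
    have "matrix_div R x $ p = 0"
      using coefficients x by (simp add: elastic_coefficients_def)
    then show ?thesis by (simp add: matrix_div_def R'_def)
  qed
  have \<sigma>': "(\<sigma> j has_derivative (\<lambda>h. R' i j h
      + (\<Sum>l\<in>UNIV. d (?e l) (t, x) $ i * R' l j h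
          + frechet_derivative (d (?e l)) (at (t, x)) (0, h) $ i * R x $ l $ j)
      + (lam x * (if i = j then \<Sum>k\<in>UNIV. frechet_derivative (d (?e k)) (at (t, x)) (0, h) $ k else 0)
          + frechet_derivative lam (at x) h * (if i = j then \<Sum>k\<in>UNIV. d (?e k) (t, x) $ k else 0))
      + (mu x * (frechet_derivative (d (?e j)) (at (t, x)) (0, h) $ i
            + frechet_derivative (d (?e i)) (at (t, x)) (0, h) $ j)
          + frechet_derivative mu (at x) h * (d (?e j) (t, x) $ i + d (?e i) (t, x) $ j)))) (at x)" for j
  proof -
    have "((\<lambda>y. if i = j then \<Sum>k\<in>UNIV. d (?e k) (t, y) $ k else 0) has_derivative
        (\<lambda>h. if i = j then \<Sum>k\<in>UNIV. frechet_derivative (d (?e k)) (at (t, x)) (0, h) $ k else 0)) (at x)"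
      by (cases "i = j") (simp_all add: has_derivative_sum[OF d'])
    then show ?thesis
      unfolding \<sigma>_def[abs_def]
      by (intro has_derivative_add has_derivative_mult has_derivative_sum d' R' lam' mu')
  qed
  have "frechet_derivative (\<lambda>y. stress lam mu R (\<lambda>y. v (t, y)) y $ i $ j) (at x) (axis j 1)
      = R' i j (axis j 1)
      + (\<Sum>l\<in>UNIV. d (?e l) (t, x) $ i * R' l j (axis j 1) + dd (?e j) (?e l) $ i * R x $ l $ j)
      + (lam x * (if i = j then \<Sum>k\<in>UNIV. dd (?e j) (?e k) $ k else 0)
          + frechet_derivative lam (at x) (axis j 1) * (if i = j then \<Sum>k\<in>UNIV. d (?e k) (t, x) $ k else 0))
      + (mu x * (dd (?e j) (?e j) $ i + dd (?e j) (?e i) $ j)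
          + frechet_derivative mu (at x) (axis j 1) * (d (?e j) (t, x) $ i + d (?e i) (t, x) $ j))" for j
    unfolding dd_def
    by (rule fun_cong[OF frechet_derivative_at[OF has_derivative_transform_within_open[OF \<sigma>' domain x]],
          symmetric, THEN trans]) (simp_all add: stress)
  \<comment> \<open>Exchanging the sums over \<open>j\<close> and \<open>l\<close> groups the
    derivatives of \<open>R\<close> into the row divergences of \<open>div_R\<close>.\<close>
  then have "matrix_div (stress lam mu R (\<lambda>y. v (t, y))) x $ i =
      (\<Sum>j\<in>UNIV. R' i j (axis j 1))
      + (\<Sum>l\<in>UNIV. d (?e l) (t, x) $ i * (\<Sum>j\<in>UNIV. R' l j (axis j 1)))
      + (\<Sum>j\<in>UNIV. (\<Sum>l\<in>UNIV. dd (?e j) (?e l) $ i * R x $ l $ j)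
          + lam x * (if i = j then \<Sum>k\<in>UNIV. dd (?e j) (?e k) $ k else 0)
          + mu x * (dd (?e j) (?e j) $ i + dd (?e j) (?e i) $ j))
      + (\<Sum>j\<in>UNIV. (if i = j then frechet_derivative lam (at x) (axis j 1) *
            (\<Sum>k\<in>UNIV. d (?e k) (t, x) $ k) else 0)
          + frechet_derivative mu (at x) (axis j 1) * (d (?e j) (t, x) $ i + d (?e i) (t, x) $ j))"
    unfolding matrix_div_def by (simp add: sum_3 distrib_left)
  then show ?thesis
    unfolding second_order_sum first_order_sum d_def[symmetric] dd_def[symmetric]
    by (simp add: elastic_op_def time div_R)
qed

end

section \<open>Passage to complex fields and identification of the symbol\<close>

lemma bounded_linear_vector_smult: "bounded_linear (\<lambda>v :: complex^'n. c *s v)"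
  using bounded_linear_vec_lambda[OF bounded_linear_mult_right[of c]]
  by (simp add: vector_scalar_mult_def)

text \<open>The two factors \<open>-\<i>\<close> give the sign that makes
  \<open>second_order_coeff\<close> itself the coefficient of the word
  \<open>[b, c]\<close>.\<close>

lemma D_word_2:
  assumes "smooth_open X u" "z \<in> X"
  shows "D_word [b, c] u z = - frechet_derivative (\<lambda>z. frechet_derivative u (at z) c) (at z) b"
proof -
  have "(\<lambda>z. frechet_derivative u (at z) c) differentiable (at z)"
    by (rule smooth_open_differentiable[OF smooth_open_frechet_derivative[OF assms(1)] assms(2)])
  from frechet_derivative_linear_compose[OF bounded_linear_vector_smult this]
  show ?thesis by (simp only: D_word.simps) (simp add: vec_eq_iff flip: mult.assoc)
qed

context elastic_medium
begin

lemma smooth_on_spacetime_position: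
  "smooth_on (closure \<Omega>) f \<Longrightarrow> smooth_on (UNIV \<times> closure \<Omega>) (\<lambda>z :: spacetime. f (snd z))"
  by (rule smooth_on_compose_linear[OF _ bounded_linear_snd]) auto

lemma smooth_on_second_order_coeff:
  "smooth_on (UNIV \<times> closure \<Omega>) (\<lambda>z :: spacetime.
     second_order_coeff (rho (snd z)) (lam (snd z)) (mu (snd z)) (R (snd z)) b c i k)"
proof -
  have bilinear: "(A *v \<beta>) \<bullet> \<gamma> = (\<Sum>i\<in>UNIV. (\<Sum>j\<in>UNIV. A $ i $ j * \<beta> $ j) * \<gamma> $ i)"
    for A :: "real^3^3" and \<beta> \<gamma> :: "real^3"
    by (simp add: inner_vec_def matrix_vector_mult_def)
  have "smooth_on (closure \<Omega>) (\<lambda>x. second_order_coeff (rho x) (lam x) (mu x) (R x) b c i k)"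
    unfolding second_order_coeff_def bilinear
    by (intro smooth_on_add smooth_on_diff smooth_on_mult smooth_on_sum smooth_on_const smooth_on_vec_nth
        smooth_coefficients)
  then show ?thesis by (rule smooth_on_spacetime_position)
qed

lemma smooth_on_first_order_coeff:
  assumes "\<And>j. smooth_on (closure \<Omega>) (dl j)" "\<And>j. smooth_on (closure \<Omega>) (dm j)"
  shows "smooth_on (UNIV \<times> closure \<Omega>)
    (\<lambda>z :: spacetime. first_order_coeff (\<lambda>j. dl j (snd z)) (\<lambda>j. dm j (snd z)) b i k)"
proof -
  have "smooth_on (closure \<Omega>) (\<lambda>x. first_order_coeff (\<lambda>j. dl j x) (\<lambda>j. dm j x) b i k)"
    unfolding first_order_coeff_def
    by (intro smooth_on_add smooth_on_mult smooth_on_sum smooth_on_const assms)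
  then show ?thesis by (rule smooth_on_spacetime_position)
qed

text \<open>At \<open>b = c = \<zeta>\<close> the last two terms of the form merge into
  \<open>lam x + mu x\<close> times \<open>outer_square\<close>, giving the polynomial form of the
  symbol.\<close>

lemma elastic_symbol_second_order_coeff:
  assumes "x \<in> closure \<Omega>"
  shows "elastic_symbol rho lam mu R ((t, x), \<zeta>) $ i $ k
    = second_order_coeff (rho x) (lam x) (mu x) (R x) \<zeta> \<zeta> i k"
  by (cases \<zeta>) (simp add: elastic_symbol_eq[OF assms] q_S_eq[OF assms] second_order_coeff_def
      outer_square_def mat_def power2_eq_square algebra_simps)

lemma complexify_elastic_op_expansion:
  assumes u: "smooth_open spacetime_domain u" and x: "x \<in> \<Omega>"
  shows "complexify_op (elastic_op rho lam mu R) u (t, x) $ i =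
    - (\<Sum>b\<in>Basis. \<Sum>c\<in>Basis. \<Sum>k\<in>UNIV.
        complex_of_real (second_order_coeff (rho x) (lam x) (mu x) (R x) b c i k) *
        frechet_derivative (\<lambda>z. frechet_derivative u (at z) c) (at (t, x)) b $ k)
    + (\<Sum>b\<in>Basis. \<Sum>k\<in>UNIV. complex_of_real (first_order_coeff
        (\<lambda>j. frechet_derivative lam (at x) (axis j 1))
        (\<lambda>j. frechet_derivative mu (at x) (axis j 1)) b i k) * frechet_derivative u (at (t, x)) b $ k)"
proof -
  have z: "(t, x) \<in> spacetime_domain" using x by simp
  have u_diff: "u differentiable (at (t, x))" by (rule smooth_open_differentiable[OF u z])
  let ?L = "\<lambda>f v :: complex^3. \<chi> j. f (v $ j)"
  \<comment> \<open>A general real-linear \<open>f\<close> makes real and imaginary parts two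
    instances of one formula, as the coefficients are real.\<close>
  have expansion: "elastic_op rho lam mu R (\<lambda>z. ?L f (u z)) (t, x) $ i =
    - (\<Sum>b\<in>Basis. \<Sum>c\<in>Basis. \<Sum>k\<in>UNIV. second_order_coeff (rho x) (lam x) (mu x) (R x) b c i k *
        f (frechet_derivative (\<lambda>z. frechet_derivative u (at z) c) (at (t, x)) b $ k))
    + (\<Sum>b\<in>Basis. \<Sum>k\<in>UNIV. first_order_coeff (\<lambda>j. frechet_derivative lam (at x) (axis j 1))
        (\<lambda>j. frechet_derivative mu (at x) (axis j 1)) b i k * f (frechet_derivative u (at (t, x)) b $ k))"
    if "bounded_linear f" for f
  proof -
    note L = bounded_linear_vec_lambda[OF that]
    show ?thesis
      unfolding elastic_op_expansion[OF smooth_open_linear_compose[OF L open_spacetime_domain u] x]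
        frechet_derivative2_linear_compose[OF L open_spacetime_domain u z]
        frechet_derivative_linear_compose[OF L u_diff] vec_lambda_beta ..
  qed
  show ?thesis
    unfolding complexify_op_def vec_lambda_beta expansion[OF bounded_linear_Re]
      expansion[OF bounded_linear_Im]
    by (simp add: complex_eq_iff)
qed

lemma has_principal_symbol_elastic:
  "has_principal_symbol (UNIV \<times> \<Omega>) 2 (complexify_op (elastic_op rho lam mu R))
    (\<lambda>w. complexify_matrix (elastic_symbol rho lam mu R w))"
proof -
  \<comment> \<open>Coefficients must be smooth up to the boundary, so the gradients are replaced by
    smooth functions on the closure that agree with them inside.\<close>
  have "\<exists>dl. \<forall>j. smooth_on (closure \<Omega>) (dl j) \<and>
      (\<forall>x\<in>\<Omega>. dl j x = frechet_derivative lam (at x) (axis j 1))"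
    by (intro choice allI smooth_on_closure_derivative domain smooth_coefficients)
  then obtain dl where dl: "\<And>j. smooth_on (closure \<Omega>) (dl j)"
      "\<And>j x. x \<in> \<Omega> \<Longrightarrow> dl j x = frechet_derivative lam (at x) (axis j 1)"
    by blast
  have "\<exists>dm. \<forall>j. smooth_on (closure \<Omega>) (dm j) \<and>
      (\<forall>x\<in>\<Omega>. dm j x = frechet_derivative mu (at x) (axis j 1))"
    by (intro choice allI smooth_on_closure_derivative domain smooth_coefficients)
  then obtain dm where dm: "\<And>j. smooth_on (closure \<Omega>) (dm j)"
      "\<And>j x. x \<in> \<Omega> \<Longrightarrow> dm j x = frechet_derivative mu (at x) (axis j 1)"
    by blast
  \<comment> \<open>The factor \<open>\<i>\<close> comes from rewriting a partial derivative as
    \<open>\<i>\<close> times \<open>D\<close>.\<close>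
  define A1 :: "spacetime \<Rightarrow> spacetime \<Rightarrow> complex^3^3" where
    "A1 b z = (\<chi> i k. \<i> * complex_of_real
      (first_order_coeff (\<lambda>j. dl j (snd z)) (\<lambda>j. dm j (snd z)) b i k))" for b z
  define A2 :: "spacetime \<Rightarrow> spacetime \<Rightarrow> spacetime \<Rightarrow> complex^3^3" where
    "A2 b c z = (\<chi> i k. complex_of_real
      (second_order_coeff (rho (snd z)) (lam (snd z)) (mu (snd z)) (R (snd z)) b c i k))" for b c z
  \<comment> \<open>The empty word gets zero, there being no zeroth order term; words longer than
    two lie outside both sums.\<close>
  define A :: "spacetime list \<Rightarrow> spacetime \<Rightarrow> complex^3^3" where
    "A bs = (case bs of [b] \<Rightarrow> A1 b | [b, c] \<Rightarrow> A2 b c | _ \<Rightarrow> (\<lambda>z. 0))" for bs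
  have cl: "closure (UNIV \<times> \<Omega> :: spacetime set) = UNIV \<times> closure \<Omega>"
    by (simp add: closure_Times)
  have A1: "smooth_on (UNIV \<times> closure \<Omega>) (A1 b)" for b
    unfolding A1_def[abs_def]
    by (intro smooth_on_vec_lambda smooth_on_mult smooth_on_const
        bounded_linear.smooth_on_compose[OF bounded_linear_of_real] smooth_on_first_order_coeff dl dm)
  have A2: "smooth_on (UNIV \<times> closure \<Omega>) (A2 b c)" for b c
    unfolding A2_def[abs_def]
    by (intro smooth_on_vec_lambda bounded_linear.smooth_on_compose[OF bounded_linear_of_real]
        smooth_on_second_order_coeff)
  have "smooth_on (UNIV \<times> closure \<Omega>) (A bs)" for bs
    by (auto simp: A_def A1 A2 smooth_on_const split: list.split)
  moreover have "complexify_op (elastic_op rho lam mu R) u z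
      = (\<Sum>bs | set bs \<subseteq> Basis \<and> length bs \<le> 2. A bs z *v D_word bs u z)"
    if u: "smooth_open (UNIV \<times> \<Omega>) u" and z: "z \<in> UNIV \<times> \<Omega>" for u z
  proof -
    obtain t x where tx: "z = (t, x)" "x \<in> \<Omega>" using z by auto
    have words: "(\<Sum>bs | set bs \<subseteq> Basis \<and> length bs \<le> 2. A bs z *v D_word bs u z)
      = (\<Sum>b\<in>Basis. A1 b z *v D_word [b] u z) + (\<Sum>b\<in>Basis. \<Sum>c\<in>Basis. A2 b c z *v D_word [b, c] u z)"
      by (simp add: sum_words_le_2 A_def del: D_word.simps)
    have i_cancel: "- (\<i> * a * (\<i> * b)) = a * b" for a b :: complex
      by (simp add: complex_eq_iff algebra_simps)
    have "(A1 b z *v D_word [b] u z) $ i = (\<Sum>k\<in>UNIV. complex_of_real (first_order_coeff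
        (\<lambda>j. frechet_derivative lam (at x) (axis j 1))
        (\<lambda>j. frechet_derivative mu (at x) (axis j 1)) b i k) * frechet_derivative u (at (t, x)) b $ k)"
      for b i
      using tx i_cancel by (simp add: A1_def matrix_vector_mult_def dl dm)
    moreover have "(A2 b c z *v D_word [b, c] u z) $ i = - (\<Sum>k\<in>UNIV.
        complex_of_real (second_order_coeff (rho x) (lam x) (mu x) (R x) b c i k) *
        frechet_derivative (\<lambda>z. frechet_derivative u (at z) c) (at (t, x)) b $ k)" for b c i
      unfolding D_word_2[OF u z] using tx
      by (simp add: A2_def matrix_vector_mult_def sum_negf)
    ultimately show ?thesis
      unfolding words
      unfolding vec_eq_iff vector_add_component sum_component tx(1)
      by (simp add: complexify_elastic_op_expansion[OF u tx(2)] sum_negf del: D_word.simps)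
  qed
  moreover have "complexify_matrix (elastic_symbol rho lam mu R (z, \<zeta>))
      = (\<Sum>bs | set bs \<subseteq> Basis \<and> length bs = 2. (\<Prod>b\<leftarrow>bs. \<zeta> \<bullet> b) *\<^sub>R A bs z)"
    if z: "z \<in> UNIV \<times> closure \<Omega>" for z \<zeta>
  proof -
    obtain t x where tx: "z = (t, x)" "x \<in> closure \<Omega>" using z by auto
    have "complexify_matrix (elastic_symbol rho lam mu R (z, \<zeta>)) $ i $ k
        = (\<Sum>b\<in>Basis. \<Sum>c\<in>Basis. ((\<zeta> \<bullet> b) * (\<zeta> \<bullet> c)) *\<^sub>R A2 b c z) $ i $ k" for i k
    proof -
      have "complexify_matrix (elastic_symbol rho lam mu R (z, \<zeta>)) $ i $ k
          = complex_of_real (second_order_coeff (rho x) (lam x) (mu x) (R x) \<zeta> \<zeta> i k)"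
        by (simp add: complexify_matrix_def tx elastic_symbol_second_order_coeff)
      also have "second_order_coeff (rho x) (lam x) (mu x) (R x) \<zeta> \<zeta> i k
          = (\<Sum>b\<in>Basis. \<Sum>c\<in>Basis. (\<zeta> \<bullet> b) * (\<zeta> \<bullet> c) *
              second_order_coeff (rho x) (lam x) (mu x) (R x) b c i k)"
        by (rule sum_Basis_bilinear[OF bilinear_second_order_coeff, symmetric])
      finally show ?thesis
        by (simp add: tx A2_def sum_component scaleR_conv_of_real[where 'a = complex])
    qed
    then have "complexify_matrix (elastic_symbol rho lam mu R (z, \<zeta>))
        = (\<Sum>b\<in>Basis. \<Sum>c\<in>Basis. ((\<zeta> \<bullet> b) * (\<zeta> \<bullet> c)) *\<^sub>R A2 b c z)"
      by (simp only: vec_eq_iff) blast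
    then show ?thesis
      by (simp add: sum_words_2 A_def)
  qed
  ultimately show ?thesis
    unfolding has_principal_symbol_def cl
    by (intro exI[of _ A]) (auto simp: cotangent0_def)
qed

end

theorem proposition4p1:
  fixes \<Omega> :: "(real^3) set"
    and rho lam mu :: "real^3 \<Rightarrow> real"
    and R :: "real^3 \<Rightarrow> real^3^3"
  assumes "smooth_bounded_domain \<Omega>"
    and "elastic_coefficients \<Omega> rho lam mu R"
    and "\<And>x \<xi>. x \<in> closure \<Omega> \<Longrightarrow> \<xi> \<noteq> 0 \<Longrightarrow> mu x * (norm \<xi>)\<^sup>2 + (R x *v \<xi>) \<bullet> \<xi> > 0"
  shows "real_principal_type (cotangent0 (UNIV \<times> closure \<Omega>)) (q_S rho mu R)
    \<and> real_principal_type (cotangent0 (UNIV \<times> closure \<Omega>)) (q_P rho lam mu R)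
    \<and> real_principal_type (cotangent0 (UNIV \<times> closure \<Omega>))
         (\<lambda>w. q_S rho mu R w * q_P rho lam mu R w)
    \<and> has_principal_symbol (UNIV \<times> \<Omega>) 2 (complexify_op (elastic_op rho lam mu R))
         (\<lambda>w. complexify_matrix (elastic_symbol rho lam mu R w))
    \<and> real_principal_type_system (UNIV \<times> closure \<Omega>)
         (\<lambda>w. complexify_matrix (elastic_symbol rho lam mu R w))"
proof -
  interpret elastic_medium \<Omega> rho lam mu R
    using assms by unfold_locales (auto simp: smooth_bounded_domain_def)
  show ?thesis
    using real_principal_type_q_S real_principal_type_q_P real_principal_type_q_S_q_P
      has_principal_symbol_elastic real_principal_type_elastic by blast
qed

end
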